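(* Let $\varepsilon>0$, $\beta\in(0,\tfrac12)$ and $\ell_{\max}\in\mathbb{N}$. Let $\widehat{\mathcal{M}}$ be the randomized algorithm $\mathrm{DPApproxDistinctCount}(\,\cdot\,;\ell_{\max},\varepsilon,\beta)$ described in the context, which on input $D$ outputs $(\hat\ell,\hat\nu)\in[\ell_{\max}]\times\mathbb{R}$. Then: (1) Privacy: $\widehat{\mathcal{M}}$ is $\varepsilon$-differentially private. (2) Lower bound: for every $D\in(\Omega^* )^n$, $\Pr_{(\hat\ell,\hat\nu)\gets\widehat{\mathcal{M}}(D)}\big[\hat\nu\le\mathrm{DC}(D)\big]\ge1-\beta$. (3) Upper bound: if $D=(u_1,\dots,u_n)\in(\Omega^* )^n$ satisfies $\max_{i\in[n]}|u_i|\le\ell_*\le\ell_{\max}$, then \[\Pr_{(\hat\ell,\hat\nu)\gets\widehat{\mathcal{M}}(D)}\Big[\hat\nu\ge\tfrac12\mathrm{DC}(D)-\frac{28\ell_*}{\varepsilon}\log\Big(\frac{\ell_{\max}}{\beta}\Big)\Big]\ge1-2\beta.\] (4) Computational efficiency: $\widehat{\mathcal{M}}(D)$ has running time $O(|D|+\ell_{\max}\log\ell_{\max})$, where $|D|:=\sum_i|u_i|$.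
   Context: $\Omega$ is a universe of elements equipped with a lexicographic (total) order, and $\Omega^*$ denotes the collection of finite subsets of $\Omega$. A dataset is $D=(u_1,\dots,u_n)\in(\Omega^* )^n$, where $u_i$ is the finite set contributed by person $i$; $[k]=\{1,\dots,k\}$. Define $\mathrm{DC}(D)=\big|\bigcup_{i\in[n]}u_i\big|$. Two datasets are neighboring if one is obtained from the other by adding or removing one person's entry $u_i$. A randomized algorithm $M$ is $\varepsilon$-differentially private if for all neighboring $D,D'$ and all measurable $S$, $\Pr[M(D)\in S]\le e^{\varepsilon}\Pr[M(D')\in S]$. $\mathrm{Lap}(b)$ denotes the Laplace distribution with mean $0$ and density $\frac{1}{2b}e^{-|x|/b}$. Generalized exponential mechanism $\mathrm{GEM}(D;\{q_i\}_{i\in[m]},\{\Delta_i\}_{i\in[m]},\varepsilon',\beta)$ (for real-valued queries $q_i$ with sensitivity at most $\Delta_i>0$): set $t=\frac{2}{\varepsilon'}\log(m/\beta)$, compute $s_i=\min_{j\in[m]}\frac{(q_i(D)-t\Delta_i)-(q_j(D)-t\Delta_j)}{\Delta_i+\Delta_j}$, and output $\hat i\in[m]$ with probability $\exp(\varepsilon' s_i/2)/\sum_k\exp(\varepsilon' s_k/2)$. Algorithm $\mathrm{DPApproxDistinctCount}(D;\ell_{\max},\varepsilon,\beta)$: start with $S=\emptyset$. For $\ell=1,\dots,\ell_{\max}$: for $i=1,\dots,n$ with $u_i\setminus S\neq\emptyset$, let $v$ be the lexicographically first element of $u_i\setminus S$ and set $S\gets S\cup\{v\}$; after the inner loop define $q_\ell(D)=|S|-\frac{2\ell}{\varepsilon}\log\big(\frac{1}{2\beta}\big)$.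 Then set $\hat\ell\gets\mathrm{GEM}(D;\{q_\ell\}_{\ell\in[\ell_{\max}]},\{\ell\}_{\ell\in[\ell_{\max}]},\varepsilon/2,\beta)$, $\hat\nu\gets q_{\hat\ell}(D)+\mathrm{Lap}(2\hat\ell/\varepsilon)$, and output $(\hat\ell,\hat\nu)$.
   Formalization: ℓ_* ≥ 1 is required: for ℓ_* = 0 (all u_i empty) claim (3) fails for β < 1/3, as Pr[ν̂ ≥ 0] = β. In (4), on a real RAM with unit-cost dictionary, each u_i is given sorted in the order of Ω, empty u_i are not stored, and the bound is O(max(1, |D| + ℓ_max log ℓ_max)). *)

theory Defs
  imports "HOL-Probability.Probability" "HOL-Library.Stream"
begin

section \<open>Datasets, distinct counts and differential privacy\<close>

definition datasets :: "'a set list set" where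
  "datasets = {D. \<forall>u\<in>set D. finite u}"

definition distinct_count :: "'a set list \<Rightarrow> nat" where
  "distinct_count D = card (\<Union>(set D))"

definition dataset_size :: "'a set list \<Rightarrow> nat" where
  "dataset_size D = (\<Sum>u\<leftarrow>D. card u)"

definition neighboring :: "'a set list \<Rightarrow> 'a set list \<Rightarrow> bool" where
  "neighboring D D' \<longleftrightarrow>
     (\<exists>xs u ys. (D = xs @ u # ys \<and> D' = xs @ ys) \<or> (D = xs @ ys \<and> D' = xs @ u # ys))"

text \<open>\<open>N\<close> only supplies the measurable space of outputs. The first conjunct says that \<open>M\<close> is a
  randomized algorithm with outputs in \<open>N\<close>, i.e. every \<open>M D\<close> is a probability measure on \<open>N\<close>.\<close>

definition differentially_private ::
    "real \<Rightarrow> 'b measure \<Rightarrow> ('a set list \<Rightarrow> 'b measure) \<Rightarrow> bool" where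
  "differentially_private \<epsilon> N M \<longleftrightarrow>
     (\<forall>D\<in>datasets. M D \<in> space (prob_algebra N)) \<and>
     (\<forall>D\<in>datasets. \<forall>D'\<in>datasets. neighboring D D' \<longrightarrow>
        (\<forall>S\<in>sets N. measure (M D) S \<le> exp \<epsilon> * measure (M D') S))"

definition laplace :: "real \<Rightarrow> real measure" where
  "laplace b = density lborel (\<lambda>x. ennreal (1 / (2 * b) * exp (- \<bar>x\<bar> / b)))"


section \<open>The generalized exponential mechanism\<close>

definition gem_score ::
    "'d \<Rightarrow> nat \<Rightarrow> (nat \<Rightarrow> 'd \<Rightarrow> real) \<Rightarrow> (nat \<Rightarrow> real) \<Rightarrow> real \<Rightarrow> real \<Rightarrow> nat \<Rightarrow> real" where
  "gem_score D m q \<Delta> \<epsilon> \<beta> i =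
     (let t = 2 / \<epsilon> * ln (real m / \<beta>)
      in Min ((\<lambda>j. ((q i D - t * \<Delta> i) - (q j D - t * \<Delta> j)) / (\<Delta> i + \<Delta> j)) ` {1..m}))"

definition gem ::
    "'d \<Rightarrow> nat \<Rightarrow> (nat \<Rightarrow> 'd \<Rightarrow> real) \<Rightarrow> (nat \<Rightarrow> real) \<Rightarrow> real \<Rightarrow> real \<Rightarrow> nat pmf" where
  "gem D m q \<Delta> \<epsilon> \<beta> =
     embed_pmf (\<lambda>i. if i \<in> {1..m}
       then exp (\<epsilon> * gem_score D m q \<Delta> \<epsilon> \<beta> i / 2) /
            (\<Sum>k\<in>{1..m}. exp (\<epsilon> * gem_score D m q \<Delta> \<epsilon> \<beta> k / 2))
       else 0)"


section \<open>The algorithm DPApproxDistinctCount\<close>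

definition add_first :: "'a::linorder set \<Rightarrow> 'a set \<Rightarrow> 'a set" where
  "add_first u S = (if u - S \<noteq> {} then insert (Min (u - S)) S else S)"

text \<open>\<open>greedy D l\<close> is the set \<open>S\<close> after \<open>l\<close> iterations of the outer loop; \<^const>\<open>fold\<close> traverses
  \<open>D\<close> from left to right.\<close>

definition greedy :: "'a::linorder set list \<Rightarrow> nat \<Rightarrow> 'a set" where
  "greedy D l = ((fold add_first D) ^^ l) {}"

definition count_query :: "real \<Rightarrow> real \<Rightarrow> nat \<Rightarrow> 'a::linorder set list \<Rightarrow> real" where
  "count_query \<epsilon> \<beta> l D = real (card (greedy D l)) - 2 * real l / \<epsilon> * ln (1 / (2 * \<beta>))"

abbreviation output_space :: "(nat \<times> real) measure" where
  "output_space \<equiv> count_space UNIV \<Otimes>\<^sub>M borel"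

definition dp_approx_distinct_count ::
    "nat \<Rightarrow> real \<Rightarrow> real \<Rightarrow> 'a::linorder set list \<Rightarrow> (nat \<times> real) measure" where
  "dp_approx_distinct_count lmax \<epsilon> \<beta> D =
     measure_pmf (gem D lmax (count_query \<epsilon> \<beta>) real (\<epsilon> / 2) \<beta>) \<bind>
       (\<lambda>l. distr (laplace (2 * real l / \<epsilon>)) output_space (\<lambda>x. (l, count_query \<epsilon> \<beta> l D + x)))"


section \<open>Randomized real RAM\<close>

text \<open>
  Running time is measured on a randomized real RAM, programmed in a small imperative language.
  The machine has registers and arrays of natural numbers and of real numbers, exact real
  arithmetic including \<open>exp\<close> and \<open>ln\<close>, a source of independent uniform samples from \<open>[0,1]\<close>, a
  read-only array of elements of the universe, and one dictionary (idealized hash table) of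
  such elements with constant-time insertion and lookup. Reals cannot be converted to naturals.

  Every executed assignment, array update, insertion, sampling step and branch or loop test costs
  one unit. The expressions of a fixed program have bounded size, so charging per operator would
  change running times by at most a factor depending on the program only.
\<close>

type_synonym vname = string

datatype nexp =
    NConst nat | NVar vname | NGet vname nexp
  | NPlus nexp nexp | NMinus nexp nexp | NHalf nexp

datatype rexp =
    ROf nexp | RVar vname | RGet vname nexp
  | RPlus rexp rexp | RMinus rexp rexp | RTimes rexp rexp | RDivide rexp rexp
  | RExp rexp | RLn rexp

datatype bexp =
    NLess nexp nexp | RLess rexp rexp | Stored nexp
  | BNot bexp | BAnd bexp bexp

datatype com =
    SKIP
  | NAssign vname nexp | NPut vname nexp nexp
  | RAssign vname rexp | RPut vname nexp rexp
  | Insert nexp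
  | Sample vname
  | Seq com com
  | IfThenElse bexp com com
  | While bexp com

record 'a state =
  nreg :: "vname \<Rightarrow> nat"
  rreg :: "vname \<Rightarrow> real"
  narr :: "vname \<Rightarrow> nat \<Rightarrow> nat"
  rarr :: "vname \<Rightarrow> nat \<Rightarrow> real"
  elems :: "nat \<Rightarrow> 'a"
  dict :: "'a set"
  tape :: "real stream"

primrec neval :: "nexp \<Rightarrow> 'a state \<Rightarrow> nat" where
  "neval (NConst k) s = k"
| "neval (NVar x) s = nreg s x"
| "neval (NGet a e) s = narr s a (neval e s)"
| "neval (NPlus e1 e2) s = neval e1 s + neval e2 s"
| "neval (NMinus e1 e2) s = neval e1 s - neval e2 s"
| "neval (NHalf e) s = neval e s div 2"

primrec reval :: "rexp \<Rightarrow> 'a state \<Rightarrow> real" where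
  "reval (ROf e) s = real (neval e s)"
| "reval (RVar x) s = rreg s x"
| "reval (RGet a e) s = rarr s a (neval e s)"
| "reval (RPlus e1 e2) s = reval e1 s + reval e2 s"
| "reval (RMinus e1 e2) s = reval e1 s - reval e2 s"
| "reval (RTimes e1 e2) s = reval e1 s * reval e2 s"
| "reval (RDivide e1 e2) s = reval e1 s / reval e2 s"
| "reval (RExp e) s = exp (reval e s)"
| "reval (RLn e) s = ln (reval e s)"

primrec beval :: "bexp \<Rightarrow> 'a state \<Rightarrow> bool" where
  "beval (NLess e1 e2) s \<longleftrightarrow> neval e1 s < neval e2 s"
| "beval (RLess e1 e2) s \<longleftrightarrow> reval e1 s < reval e2 s"
| "beval (Stored e) s \<longleftrightarrow> elems s (neval e s) \<in> dict s"
| "beval (BNot b) s \<longleftrightarrow> \<not> beval b s"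
| "beval (BAnd b1 b2) s \<longleftrightarrow> beval b1 s \<and> beval b2 s"

text \<open>\<open>exec c s k s'\<close>: started in state \<open>s\<close>, program \<open>c\<close> halts after \<open>k\<close> steps in state \<open>s'\<close>.\<close>

inductive exec :: "com \<Rightarrow> 'a state \<Rightarrow> nat \<Rightarrow> 'a state \<Rightarrow> bool" where
  Skip: "exec SKIP s 0 s"
| NAssign: "exec (NAssign x e) s 1 (s\<lparr>nreg := (nreg s)(x := neval e s)\<rparr>)"
| NPut: "exec (NPut a i e) s 1
    (s\<lparr>narr := (narr s)(a := (narr s a)(neval i s := neval e s))\<rparr>)"
| RAssign: "exec (RAssign x e) s 1 (s\<lparr>rreg := (rreg s)(x := reval e s)\<rparr>)"
| RPut: "exec (RPut a i e) s 1
    (s\<lparr>rarr := (rarr s)(a := (rarr s a)(neval i s := reval e s))\<rparr>)"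
| Insert: "exec (Insert e) s 1 (s\<lparr>dict := insert (elems s (neval e s)) (dict s)\<rparr>)"
| Sample: "exec (Sample x) s 1
    (s\<lparr>rreg := (rreg s)(x := shd (tape s)), tape := stl (tape s)\<rparr>)"
| Seq: "exec c1 s k1 s1 \<Longrightarrow> exec c2 s1 k2 s2 \<Longrightarrow> exec (Seq c1 c2) s (k1 + k2) s2"
| IfTrue: "beval b s \<Longrightarrow> exec c1 s k s' \<Longrightarrow> exec (IfThenElse b c1 c2) s (Suc k) s'"
| IfFalse: "\<not> beval b s \<Longrightarrow> exec c2 s k s' \<Longrightarrow> exec (IfThenElse b c1 c2) s (Suc k) s'"
| WhileFalse: "\<not> beval b s \<Longrightarrow> exec (While b c) s 1 s"
| WhileTrue: "beval b s \<Longrightarrow> exec c s k1 s1 \<Longrightarrow> exec (While b c) s1 k2 s2 \<Longrightarrow>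
    exec (While b c) s (Suc (k1 + k2)) s2"

inductive_cases exec_SeqE: "exec (Seq c1 c2) s k s'"

lemma exec_deterministic:
  "exec c s k s' \<Longrightarrow> exec c s l t \<Longrightarrow> l = k \<and> t = s'"
proof (induction arbitrary: l t rule: exec.induct)
  case (Seq c1 s k1 s1 c2 k2 s2)
  from Seq.prems obtain k1' s1' k2' where
    "exec c1 s k1' s1'" "exec c2 s1' k2' t" "l = k1' + k2'"
    by (rule exec_SeqE)
  with Seq.IH show ?case by blast
next
  case (IfTrue b s c1 k s' c2)
  from IfTrue.prems IfTrue.hyps(1) obtain k' where "exec c1 s k' t" "l = Suc k'"
    by cases simp_all
  with IfTrue.IH show ?case by blast
next
  case (IfFalse b s c2 k s' c1)
  from IfFalse.prems IfFalse.hyps(1) obtain k' where "exec c2 s k' t" "l = Suc k'"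
    by cases simp_all
  with IfFalse.IH show ?case by blast
next
  case (WhileFalse b s c)
  from WhileFalse.prems WhileFalse.hyps show ?case by cases simp_all
next
  case (WhileTrue b s c k1 s1 k2 s2)
  from WhileTrue.prems WhileTrue.hyps(1) obtain k1' s1' k2' where
    "exec c s k1' s1'" "exec (While b c) s1' k2' t" "l = Suc (k1' + k2')"
    by cases simp_all
  with WhileTrue.IH show ?case by blast
qed (erule exec.cases; simp)+

text \<open>
  The input holds, for each person with a nonempty contribution, the list of contributed elements
  in increasing order. The lists are stored consecutively in \<^const>\<open>elems\<close>; the \<open>i\<close>-th of them
  (counting from 0) occupies positions \<open>start i, \<dots>, start (i + 1) - 1\<close>. Persons with an empty
  contribution are not stored, so the input has size \<open>O(|D|)\<close> independently of their number. Memory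
  other than the input is initially zero, and the dictionary is empty.
\<close>

definition rows :: "'a::linorder set list \<Rightarrow> 'a list list" where
  "rows D = map sorted_list_of_set (filter (\<lambda>u. u \<noteq> {}) D)"

definition init_state ::
    "nat \<Rightarrow> real \<Rightarrow> real \<Rightarrow> 'a::linorder set list \<Rightarrow> real stream \<Rightarrow> 'a state" where
  "init_state lmax \<epsilon> \<beta> D \<omega> =
     \<lparr>nreg = (\<lambda>_. 0)(''persons'' := length (rows D), ''lmax'' := lmax),
      rreg = (\<lambda>_. 0)(''epsilon'' := \<epsilon>, ''beta'' := \<beta>),
      narr = (\<lambda>_ _. 0)(''start'' :=
        (\<lambda>i. if i \<le> length (rows D) then length (concat (take i (rows D))) else 0)),
      rarr = (\<lambda>_ _. 0),
      elems = (\<lambda>i. concat (rows D) ! i),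
      dict = {},
      tape = \<omega>\<rparr>"

definition result :: "'a state \<Rightarrow> nat \<times> real" where
  "result s = (nreg s ''l'', rreg s ''nu'')"

definition random_tape :: "real stream measure" where
  "random_tape = stream_space (uniform_measure lborel {0..1})"

text \<open>Worst-case running time: the bound \<open>T\<close> has to hold for every random tape.\<close>

definition implements_in_time ::
    "com \<Rightarrow> (real stream \<Rightarrow> 'a state) \<Rightarrow> (nat \<times> real) measure \<Rightarrow> real \<Rightarrow> bool" where
  "implements_in_time c init M T \<longleftrightarrow>
     (\<exists>f \<in> random_tape \<rightarrow>\<^sub>M output_space.
        (\<forall>\<omega>. \<exists>k s. exec c (init \<omega>) k s \<and> result s = f \<omega> \<and> real k \<le> T) \<and>
        distr random_tape output_space f = M)"

end

theory Submission
  imports Defs "HOL-Library.Discrete_Functions"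
begin

text \<open>
  Privacy. Inserting a person enlarges the greedy set by at most one element per round: if
  \<open>S \<subseteq> S'\<close>, then processing the same person in both runs preserves the inclusion and does not
  enlarge the difference. Hence \<open>q\<^sub>l\<close> has sensitivity \<open>l\<close>, the GEM scores have sensitivity 1, and the
  two stages are \<open>\<epsilon> / 2\<close>-private each.

  Utility. After \<open>l\<^sub>*\<close> rounds the greedy set is the whole union, so GEM selects, up to an error of
  order \<open>l\<^sub>* / \<epsilon>\<close>, a value \<open>q\<^sub>l \<ge> DC(D)\<close>. Since \<open>q\<^sub>l\<close> is \<open>|S\<^sub>l| \<le> DC(D)\<close> minus the high-probability
  bound on the noise at level \<open>l\<close>, a large \<open>q\<^sub>l\<close> forces that noise to be small as well.

  Running time. A person who is exhausted once stays exhausted, so each step of the scan either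
  consumes an input element or discards a person for good, and all rounds together take
  \<open>O(|D| + l\<^sub>m\<^sub>a\<^sub>x)\<close> steps. The inclusion argument with \<open>S = S\<^sub>l\<close> and \<open>S' = S\<^sub>l\<^sub>+\<^sub>1\<close> also shows that \<open>|S\<^sub>l|\<close> is concave in
  \<open>l\<close>. The score of \<open>i\<close> is the least slope of a line from \<open>(-j, a\<^sub>j)\<close> to \<open>(i, a\<^sub>i)\<close>; for concave
  \<open>a\<close> these slopes first decrease and then increase in \<open>j\<close>, so that the minimum is found by binary
  search. The two random choices are sampled by inverting distribution functions.
\<close>

section \<open>Greedy rounds\<close>

lemma add_first_superset: "S \<subseteq> add_first u S"
  by (auto simp: add_first_def)

lemma add_first_subset: "finite u \<Longrightarrow> add_first u S \<subseteq> u \<union> S"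
  using Min_in[of "u - S"] by (auto simp: add_first_def)

lemma add_first_absorb: "u \<subseteq> S \<Longrightarrow> add_first u S = S"
  by (auto simp: add_first_def)

lemma finite_add_first: "finite S \<Longrightarrow> finite (add_first u S)"
  by (auto simp: add_first_def)

lemma card_add_first_le: "finite S \<Longrightarrow> card (add_first u S) \<le> Suc (card S)"
  by (auto simp: add_first_def card_insert_if)

text \<open>If \<open>u\<close> is exhausted in \<open>S\<close>, nothing changes. If the element
  that \<open>S\<close> receives already lies in \<open>S'\<close>, the gap loses it, while
  \<open>S'\<close> gains at most one element. Otherwise that element is also the least one of
  \<open>u - S'\<close>, and both sets receive the same element.\<close>

lemma add_first_mono:
  assumes "finite u" "finite S'" "S \<subseteq> S'"
  shows "add_first u S \<subseteq> add_first u S'"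
    and "card (add_first u S') + card S \<le> card (add_first u S) + card S'"
proof -
  have fS: "finite S" using assms finite_subset by blast
  have "add_first u S \<subseteq> add_first u S' \<and>
    card (add_first u S') + card S \<le> card (add_first u S) + card S'"
  proof (cases "u \<subseteq> S \<or> Min (u - S) \<in> S'")
    case True
    then show ?thesis
    proof
      assume "u \<subseteq> S"
      then show ?thesis using assms by (simp add: add_first_absorb subset_trans[of u S S'])
    next
      assume *: "Min (u - S) \<in> S'"
      show ?thesis
      proof (cases "u \<subseteq> S")
        case True
        then show ?thesis using assms by (simp add: add_first_absorb subset_trans[of u S S'])
      next
        case False
        then have "Min (u - S) \<in> u - S" using assms by (intro Min_in) auto
        with False * assms fS card_add_first_le[of S' u] show ?thesis
          using add_first_superset[of S' u] by (auto simp: add_first_def)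
      qed
    qed
  next
    case False
    then have m: "Min (u - S) \<in> u - S" using assms by (intro Min_in) auto
    have "Min (u - S') = Min (u - S)"
    proof (rule Min_eqI)
      show "Min (u - S) \<le> y" if "y \<in> u - S'" for y
        using that assms by (intro Min_le) auto
    qed (use assms m False in auto)
    with m False assms fS show ?thesis by (auto simp: add_first_def)
  qed
  then show "add_first u S \<subseteq> add_first u S'"
    and "card (add_first u S') + card S \<le> card (add_first u S) + card S'" by auto
qed

lemma fold_add_first_superset: "S \<subseteq> fold add_first D S"
  by (induction D arbitrary: S) (use add_first_superset in fastforce)+

lemma fold_add_first_subset:
  "D \<in> datasets \<Longrightarrow> fold add_first D S \<subseteq> \<Union>(set D) \<union> S"
proof (induction D arbitrary: S)
  case (Cons u D)
  then have "finite u" "D \<in> datasets" by (auto simp: datasets_def)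
  with Cons.IH[of "add_first u S"] add_first_subset[of u S] show ?case by auto
qed simp

lemma finite_fold_add_first: "finite S \<Longrightarrow> finite (fold add_first D S)"
  by (induction D arbitrary: S) (auto simp: finite_add_first)

lemma fold_add_first_mono:
  assumes "D \<in> datasets" "finite S'" "S \<subseteq> S'"
  shows "fold add_first D S \<subseteq> fold add_first D S' \<and>
    card (fold add_first D S') + card S \<le> card (fold add_first D S) + card S'"
  using assms
proof (induction D arbitrary: S S')
  case (Cons u D)
  then have u: "finite u" "D \<in> datasets" by (auto simp: datasets_def)
  note m = add_first_mono[OF u(1) Cons.prems(2,3)]
  from Cons.IH[OF u(2) finite_add_first[OF Cons.prems(2)] m(1)] m(2) show ?case by simp
qed simp

lemma greedy_0 [simp]: "greedy D 0 = {}"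
  by (simp add: greedy_def)

lemma greedy_Suc: "greedy D (Suc l) = fold add_first D (greedy D l)"
  by (simp add: greedy_def)

lemma finite_greedy: "finite (greedy D l)"
  by (induction l) (auto simp: greedy_Suc finite_fold_add_first)

lemma greedy_subset: "D \<in> datasets \<Longrightarrow> greedy D l \<subseteq> \<Union>(set D)"
  by (induction l) (use fold_add_first_subset in \<open>fastforce simp: greedy_Suc\<close>)+

lemma card_greedy_le: "D \<in> datasets \<Longrightarrow> card (greedy D l) \<le> distinct_count D"
  unfolding distinct_count_def by (intro card_mono greedy_subset) (auto simp: datasets_def)

lemma card_greedy_concave:
  assumes "D \<in> datasets"
  shows "card (greedy D (Suc (Suc l))) + card (greedy D l) \<le> 2 * card (greedy D (Suc l))"
  using fold_add_first_mono[OF assms finite_greedy[of D "Suc l"], of "greedy D l"]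
  by (simp add: greedy_Suc fold_add_first_superset)

text \<open>Before the turn of \<open>u\<close> the gap between the two runs cannot widen. That turn
  acts on the larger set only and adds at most one element. Afterwards the gap again cannot
  widen.\<close>

lemma fold_add_first_insert:
  assumes "xs @ u # ys \<in> datasets" "finite S'" "S \<subseteq> S'"
  shows "fold add_first (xs @ ys) S \<subseteq> fold add_first (xs @ u # ys) S' \<and>
    card (fold add_first (xs @ u # ys) S') + card S \<le>
      Suc (card (fold add_first (xs @ ys) S) + card S')"
proof -
  have d: "xs \<in> datasets" "ys \<in> datasets" using assms(1) by (auto simp: datasets_def)
  let ?A = "fold add_first xs S" and ?A' = "fold add_first xs S'"
  have 1: "?A \<subseteq> ?A'" "card ?A' + card S \<le> card ?A + card S'"
    using fold_add_first_mono[OF d(1) assms(2,3)] by auto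
  have f: "finite ?A'" using finite_fold_add_first assms(2) by blast
  have "?A \<subseteq> add_first u ?A'" using 1 add_first_superset by blast
  from fold_add_first_mono[OF d(2) finite_add_first[OF f] this]
  show ?thesis using 1 card_add_first_le[OF f, of u] by simp
qed

lemma card_greedy_insert:
  assumes "xs @ u # ys \<in> datasets"
  shows "greedy (xs @ ys) l \<subseteq> greedy (xs @ u # ys) l \<and>
    card (greedy (xs @ u # ys) l) \<le> card (greedy (xs @ ys) l) + l"
proof (induction l)
  case (Suc l)
  with fold_add_first_insert[OF assms finite_greedy[of "xs @ u # ys" l],
    where S = "greedy (xs @ ys) l"]
  show ?case unfolding greedy_Suc by linarith
qed simp

lemma card_greedy_sensitivity:
  assumes "D \<in> datasets" "D' \<in> datasets" "neighboring D D'"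
  shows "\<bar>real (card (greedy D l)) - real (card (greedy D' l))\<bar> \<le> real l"
proof -
  have *: "\<bar>real (card (greedy (xs @ u # ys) l)) - real (card (greedy (xs @ ys) l))\<bar> \<le> real l"
    if "xs @ u # ys \<in> datasets" for xs ys and u :: "'a set"
  proof -
    from card_greedy_insert[OF that, of l]
    have "greedy (xs @ ys) l \<subseteq> greedy (xs @ u # ys) l"
      and "card (greedy (xs @ u # ys) l) \<le> card (greedy (xs @ ys) l) + l" by blast+
    with card_mono[OF finite_greedy this(1)] show ?thesis by linarith
  qed
  from assms(3) obtain xs u ys
    where "D = xs @ u # ys \<and> D' = xs @ ys \<or> D = xs @ ys \<and> D' = xs @ u # ys"
    unfolding neighboring_def by blast
  then show ?thesis
    using *[of xs u ys] assms(1,2) by (metis abs_minus_commute)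
qed

text \<open>In every round the turn of \<open>u\<close> removes one element from what is left of
  \<open>u\<close>, and the turns of other persons can only shrink it further. Truncated subtraction
  covers a person who is already exhausted.\<close>

lemma card_diff_greedy:
  assumes "D \<in> datasets" "u \<in> set D"
  shows "card (u - greedy D l) \<le> card u - l"
proof (induction l)
  case (Suc l)
  obtain xs ys where D: "D = xs @ u # ys" using split_list[OF assms(2)] by blast
  have u: "finite u" using assms by (auto simp: datasets_def)
  let ?A = "fold add_first xs (greedy D l)"
  have sub: "u - greedy D (Suc l) \<subseteq> u - add_first u ?A"
    using fold_add_first_superset[of "add_first u ?A" ys] by (auto simp: greedy_Suc D)
  have A: "u - ?A \<subseteq> u - greedy D l"
    using fold_add_first_superset[of "greedy D l" xs] by auto
  have "card (u - add_first u ?A) \<le> card (u - ?A) - 1"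
  proof (cases "u \<subseteq> ?A")
    case True
    then have "u - ?A = {}" by auto
    then show ?thesis unfolding add_first_absorb[OF True] by (simp only: card.empty zero_le)
  next
    case False
    then have "Min (u - ?A) \<in> u - ?A" using u by (intro Min_in) auto
    moreover have "u - add_first u ?A = (u - ?A) - {Min (u - ?A)}"
      using False by (auto simp: add_first_def)
    ultimately show ?thesis by (simp add: card_Diff_singleton)
  qed
  with card_mono[OF _ sub] card_mono[OF _ A] u Suc show ?case by fastforce
qed simp

lemma greedy_exhaust:
  assumes "D \<in> datasets" "\<And>u. u \<in> set D \<Longrightarrow> card u \<le> l"
  shows "greedy D l = \<Union>(set D)"
proof
  show "\<Union>(set D) \<subseteq> greedy D l"
  proof safe
    fix x u assume u: "u \<in> set D" "x \<in> u"
    then have "card (u - greedy D l) = 0" using card_diff_greedy[OF assms(1) u(1), of l] assms(2) by fastforce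
    moreover have "finite (u - greedy D l)" using assms(1) u by (auto simp: datasets_def)
    ultimately show "x \<in> greedy D l" using u by auto
  qed
qed (rule greedy_subset[OF assms(1)])

text \<open>A person with an empty contribution never acts. The machine input leaves such persons
  out.\<close>

lemma fold_add_first_filter: "fold add_first (filter (\<lambda>u. u \<noteq> {}) D) S = fold add_first D S"
  by (induction D arbitrary: S) (auto simp: add_first_def)

section \<open>Programs with step counts\<close>

text \<open>Total correctness in which the postcondition also sees the step count. As execution is
  deterministic, the rules for basic commands are equivalences and serve as rewrite rules.\<close>

definition wp :: "com \<Rightarrow> 'a state \<Rightarrow> (nat \<Rightarrow> 'a state \<Rightarrow> bool) \<Rightarrow> bool" where
  "wp c s Q \<longleftrightarrow> (\<exists>k s'. exec c s k s' \<and> Q k s')"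

lemma wp_exec: "exec c s k s' \<Longrightarrow> wp c s Q \<longleftrightarrow> Q k s'"
  unfolding wp_def using exec_deterministic by blast

lemma wp_conseq: "wp c s Q \<Longrightarrow> (\<And>k s'. Q k s' \<Longrightarrow> Q' k s') \<Longrightarrow> wp c s Q'"
  unfolding wp_def by blast

lemma wp_basic [simp]:
  "wp SKIP s Q \<longleftrightarrow> Q 0 s"
  "wp (NAssign x e) s Q \<longleftrightarrow> Q 1 (s\<lparr>nreg := (nreg s)(x := neval e s)\<rparr>)"
  "wp (NPut a i e) s Q \<longleftrightarrow>
    Q 1 (s\<lparr>narr := (narr s)(a := (narr s a)(neval i s := neval e s))\<rparr>)"
  "wp (RAssign x d) s Q \<longleftrightarrow> Q 1 (s\<lparr>rreg := (rreg s)(x := reval d s)\<rparr>)"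
  "wp (RPut a i d) s Q \<longleftrightarrow>
    Q 1 (s\<lparr>rarr := (rarr s)(a := (rarr s a)(neval i s := reval d s))\<rparr>)"
  "wp (Insert e) s Q \<longleftrightarrow> Q 1 (s\<lparr>dict := insert (elems s (neval e s)) (dict s)\<rparr>)"
  "wp (Sample x) s Q \<longleftrightarrow>
    Q 1 (s\<lparr>rreg := (rreg s)(x := shd (tape s)), tape := stl (tape s)\<rparr>)"
  by (rule wp_exec, rule exec.intros)+

lemma wp_Seq [simp]:
  "wp (Seq c1 c2) s Q \<longleftrightarrow> wp c1 s (\<lambda>k1 s1. wp c2 s1 (\<lambda>k2. Q (k1 + k2)))"
  unfolding wp_def by (blast intro: exec.Seq elim: exec_SeqE)

inductive_cases exec_IfE: "exec (IfThenElse b c1 c2) s k s'"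

lemma wp_If [simp]:
  "wp (IfThenElse b c1 c2) s Q \<longleftrightarrow> wp (if beval b s then c1 else c2) s (\<lambda>k. Q (Suc k))"
  unfolding wp_def by (auto intro: exec.IfTrue exec.IfFalse elim!: exec_IfE)

text \<open>The potential pays for every iteration together with its successful test, so it strictly
  decreases and the loop halts. The extra unit in the bound is the final, failing test.\<close>

lemma wp_While:
  fixes \<Phi> :: "'a state \<Rightarrow> nat"
  assumes body: "\<And>s. I s \<Longrightarrow> beval b s \<Longrightarrow> wp c s (\<lambda>k s'. I s' \<and> Suc k + \<Phi> s' \<le> \<Phi> s)"
    and "I s"
  shows "wp (While b c) s (\<lambda>k s'. I s' \<and> \<not> beval b s' \<and> k + \<Phi> s' \<le> Suc (\<Phi> s))"
  using \<open>I s\<close>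
proof (induction "\<Phi> s" arbitrary: s rule: less_induct)
  case less
  show ?case
  proof (cases "beval b s")
    case True
    then obtain k1 s1 where 1: "exec c s k1 s1" "I s1" "Suc k1 + \<Phi> s1 \<le> \<Phi> s"
      using body[OF less.prems] unfolding wp_def by blast
    then obtain k2 s2 where 2: "exec (While b c) s1 k2 s2" "I s2" "\<not> beval b s2"
      "k2 + \<Phi> s2 \<le> Suc (\<Phi> s1)"
      using less.hyps[of s1] unfolding wp_def by auto
    then show ?thesis unfolding wp_def using exec.WhileTrue[OF True 1(1) 2(1)] 1(3) by fastforce
  next
    case False
    then show ?thesis unfolding wp_def using less.prems exec.WhileFalse by fastforce
  qed
qed

section \<open>Lists of active persons\<close>

lemma fold_add_first_map_filter:
  assumes "\<And>p. p \<in> set ps \<Longrightarrow> \<not> P p \<Longrightarrow> U p \<subseteq> S"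
  shows "fold (\<lambda>p. add_first (U p)) (filter P ps) S = fold (\<lambda>p. add_first (U p)) ps S"
  using assms
proof (induction ps arbitrary: S)
  case (Cons p ps)
  show ?case
  proof (cases "P p")
    case True
    have "U q \<subseteq> add_first (U p) S" if "q \<in> set ps" "\<not> P q" for q
      using Cons.prems[of q] that add_first_superset[of S "U p"] by auto
    with Cons.IH[of "add_first (U p) S"] True show ?thesis by simp
  next
    case False
    with Cons show ?thesis by (simp add: add_first_absorb)
  qed
qed simp

text \<open>A strictly increasing list is determined by its set. The list of active persons thus
  becomes a filtered enumeration of all rows, into which the omitted rows can be put back.\<close>

lemma sorted_wrt_less_eq_filter:
  fixes ps :: "nat list"
  assumes "sorted_wrt (<) ps" "set ps \<subseteq> {..<n}"
  shows "ps = filter (\<lambda>p. p \<in> set ps) [0..<n]"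
  by (rule sorted_distinct_set_unique)
     (use assms in \<open>auto simp: strict_sorted_iff sorted_wrt_filter\<close>)

text \<open>
  The persons that may still contribute are \<open>j + gap j\<close> for the indices \<open>j\<close> in \<open>js\<close>, in increasing
  order. Storing the gap makes the zero-initialized array the identity enumeration. \<open>ptr p\<close> counts
  the elements of row \<open>p\<close> already known to lie in the current set \<open>S\<close>.
\<close>

definition scan_inv ::
    "'a::linorder list list \<Rightarrow> (nat \<Rightarrow> nat) \<Rightarrow> (nat \<Rightarrow> nat) \<Rightarrow> 'a set \<Rightarrow> nat list \<Rightarrow> bool" where
  "scan_inv R gap ptr S js \<longleftrightarrow>
     finite S \<and>
     sorted_wrt (<) (map (\<lambda>j. j + gap j) js) \<and> (\<forall>j\<in>set js. j + gap j < length R) \<and>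
     (\<forall>p<length R. ptr p \<le> length (R ! p) \<and> set (take (ptr p) (R ! p)) \<subseteq> S \<and>
        (p \<in> (\<lambda>j. j + gap j) ` set js \<or> set (R ! p) \<subseteq> S))"

text \<open>A row that is not active lies inside \<open>S\<close> and stays there while
  \<open>S\<close> grows, so processing the active persons alone amounts to a full round.\<close>

lemma scan_inv_fold:
  assumes "scan_inv R gap ptr S js"
  shows "fold (\<lambda>j. add_first (set (R ! (j + gap j)))) js S = fold add_first (map set R) S"
proof -
  let ?ps = "map (\<lambda>j. j + gap j) js"
  have "fold (\<lambda>j. add_first (set (R ! (j + gap j)))) js S = fold (\<lambda>p. add_first (set (R ! p))) ?ps S"
    by (simp add: fold_map comp_def)
  also have "?ps = filter (\<lambda>p. p \<in> set ?ps) [0..<length R]"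
    by (rule sorted_wrt_less_eq_filter) (use assms in \<open>auto simp: scan_inv_def\<close>)
  also have "fold (\<lambda>p. add_first (set (R ! p))) \<dots> S =
      fold (\<lambda>p. add_first (set (R ! p))) [0..<length R] S"
    by (rule fold_add_first_map_filter) (use assms in \<open>auto simp: scan_inv_def\<close>)
  also have "\<dots> = fold add_first (map ((!) (map set R)) [0..<length (map set R)]) S"
    unfolding fold_map by (rule fold_cong) auto
  finally show ?thesis by (simp only: map_nth)
qed

text \<open>All elements before the pointer lie in \<open>S\<close>; with the pointer at the end of
  the row the person is exhausted for good.\<close>

lemma scan_inv_drop:
  assumes "scan_inv R gap ptr S (js @ r # js')" "ptr (r + gap r) = length (R ! (r + gap r))"
  shows "scan_inv R gap ptr S (js @ js')" "add_first (set (R ! (r + gap r))) S = S"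
proof -
  have "set (R ! (r + gap r)) \<subseteq> S"
    using assms unfolding scan_inv_def by (metis in_set_conv_decomp order_refl take_all_iff)
  then show "scan_inv R gap ptr S (js @ js')" "add_first (set (R ! (r + gap r))) S = S"
    using assms(1) by (auto simp: scan_inv_def sorted_wrt_append add_first_absorb)
qed

lemma scan_inv_skip:
  assumes "scan_inv R gap ptr S js" "ptr p < length (R ! p)" "R ! p ! ptr p \<in> S"
  shows "scan_inv R gap (ptr(p := Suc (ptr p))) S js"
  using assms by (auto simp: scan_inv_def take_Suc_conv_app_nth)

text \<open>Person \<open>p\<close> moves from slot \<open>r\<close> to slot \<open>w\<close>. As
  \<open>w \<le> r \<le> p\<close>, the gap \<open>p - w\<close> is not truncated and slot
  \<open>w\<close> again denotes \<open>p\<close>. The row is sorted and everything before the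
  pointer lies in \<open>S\<close>, so the first element found outside \<open>S\<close> is the one
  that the greedy step inserts.\<close>

lemma scan_inv_keep:
  assumes inv: "scan_inv R gap ptr S ([0..<w] @ r # [Suc r..<m])" and "w \<le> r"
    and p: "p = r + gap r" and less: "ptr p < length (R ! p)" and new: "R ! p ! ptr p \<notin> S"
    and sorted: "sorted (R ! p)"
  shows "scan_inv R (gap(w := p - w)) (ptr(p := Suc (ptr p))) (insert (R ! p ! ptr p) S)
      ([0..<Suc w] @ [Suc r..<m])"
    and "add_first (set (R ! p)) S = insert (R ! p ! ptr p) S"
proof -
  let ?gap = "gap(w := p - w)"
  have eq: "map (\<lambda>j. j + ?gap j) ([0..<Suc w] @ [Suc r..<m])
      = map (\<lambda>j. j + gap j) ([0..<w] @ r # [Suc r..<m])"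
    using \<open>w \<le> r\<close> p by simp
  have im: "(\<lambda>j. j + ?gap j) ` set ([0..<Suc w] @ [Suc r..<m])
      = (\<lambda>j. j + gap j) ` set ([0..<w] @ r # [Suc r..<m])"
    using arg_cong[OF eq, of set] by (simp only: set_map)
  \<comment> \<open>Indices change but persons do not, so the bound on indices is restated in terms
    of the image, to which \<open>im\<close> applies.\<close>
  have all: "(\<forall>j\<in>set js. j + g j < n) \<longleftrightarrow> (\<forall>i\<in>(\<lambda>j. j + g j) ` set js. i < n)"
    for g js and n :: nat by auto
  show "scan_inv R ?gap (ptr(p := Suc (ptr p))) (insert (R ! p ! ptr p) S)
      ([0..<Suc w] @ [Suc r..<m])"
    using inv less unfolding scan_inv_def all eq im
    by (auto simp: take_Suc_conv_app_nth simp del: upt_Suc)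
  have pn: "p < length R" using inv p by (auto simp: scan_inv_def)
  have "Min (set (R ! p) - S) = R ! p ! ptr p"
  proof (rule Min_eqI)
    fix y assume "y \<in> set (R ! p) - S"
    then obtain k where k: "k < length (R ! p)" "y = R ! p ! k" "y \<notin> S"
      by (auto simp: in_set_conv_nth)
    moreover have "set (take (ptr p) (R ! p)) \<subseteq> S" using inv pn by (simp add: scan_inv_def)
    ultimately have "\<not> k < ptr p" by (auto simp: in_set_conv_nth subset_iff)
    then show "R ! p ! ptr p \<le> y" using k sorted by (simp add: sorted_nth_mono)
  qed (use less new in auto)
  with less new show "add_first (set (R ! p)) S = insert (R ! p ! ptr p) S"
    by (auto simp: add_first_def dest: nth_mem)
qed

lemma nth_concat_take:
  assumes "p < length R" "k < length (R ! p)"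
  shows "concat R ! (length (concat (take p R)) + k) = R ! p ! k"
proof -
  have "R = take p R @ R ! p # drop (Suc p) R" using assms by (simp add: id_take_nth_drop)
  then have "concat R = concat (take p R) @ R ! p @ concat (drop (Suc p) R)"
    by (metis concat.simps(2) concat_append)
  with assms show ?thesis by (simp add: nth_append)
qed

lemma length_concat_take_Suc:
  "p < length R \<Longrightarrow> length (concat (take (Suc p) R)) = length (concat (take p R)) + length (R ! p)"
  by (simp add: take_Suc_conv_app_nth)

definition remaining :: "'a list list \<Rightarrow> (nat \<Rightarrow> nat) \<Rightarrow> nat" where
  "remaining R ptr = (\<Sum>p<length R. length (R ! p) - ptr p)"

lemma remaining_update:
  assumes "p < length R" "ptr p < length (R ! p)"
  shows "Suc (remaining R (ptr(p := Suc (ptr p)))) = remaining R ptr"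
proof -
  have "sum (\<lambda>q. length (R ! q) - (ptr(p := Suc (ptr p))) q) ({..<length R} - {p}) =
      sum (\<lambda>q. length (R ! q) - ptr q) ({..<length R} - {p})"
    by (intro sum.cong) auto
  with assms show ?thesis by (simp add: remaining_def sum.remove[of _ p] Suc_diff_Suc)
qed

section \<open>The scan program and the rounds\<close>

notation Seq (infixr ";;" 60)

text \<open>The array of active persons is compacted in place, with read position \<open>r\<close>
  and write position \<open>w\<close>. If the element at the pointer is already stored, only the
  pointer advances, so the same person is tried again in the next iteration. A person leaves the
  array only when found to be exhausted.\<close>

definition scan_body :: com where
  "scan_body =
     NAssign ''p'' (NPlus (NVar ''r'') (NGet ''gap'' (NVar ''r'')));;
     IfThenElse
       (NLess (NPlus (NGet ''start'' (NVar ''p'')) (NGet ''ptr'' (NVar ''p'')))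
              (NGet ''start'' (NPlus (NVar ''p'') (NConst 1))))
       (IfThenElse
          (Stored (NPlus (NGet ''start'' (NVar ''p'')) (NGet ''ptr'' (NVar ''p''))))
          SKIP
          (Insert (NPlus (NGet ''start'' (NVar ''p'')) (NGet ''ptr'' (NVar ''p'')));;
           NAssign ''cnt'' (NPlus (NVar ''cnt'') (NConst 1));;
           NPut ''gap'' (NVar ''w'') (NMinus (NVar ''p'') (NVar ''w''));;
           NAssign ''w'' (NPlus (NVar ''w'') (NConst 1));;
           NAssign ''r'' (NPlus (NVar ''r'') (NConst 1)));;
        NPut ''ptr'' (NVar ''p'') (NPlus (NGet ''ptr'' (NVar ''p'')) (NConst 1)))
       (NAssign ''r'' (NPlus (NVar ''r'') (NConst 1)))"

definition scan :: com where
  "scan = While (NLess (NVar ''r'') (NVar ''m'')) scan_body"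

definition starts :: "'a list list \<Rightarrow> nat \<Rightarrow> nat" where
  "starts R i = (if i \<le> length R then length (concat (take i R)) else 0)"

text \<open>The part of the state that the rounds read but never change.\<close>

definition frame :: "'a list list \<Rightarrow> nat \<Rightarrow> real stream \<Rightarrow> (vname \<Rightarrow> real) \<Rightarrow> 'a state \<Rightarrow> bool" where
  "frame R lmax \<omega> rr s \<longleftrightarrow>
     nreg s ''lmax'' = lmax \<and> rreg s = rr \<and> tape s = \<omega> \<and> elems s = (!) (concat R) \<and>
     narr s ''start'' = starts R"

text \<open>
  The potential \<open>10 * (remaining R ptr + active)\<close> pays for the scan: every iteration of the loop
  either advances a pointer or discards an active person.
\<close>

lemma scan_correct:
  fixes s0 :: "'a::linorder state"
  assumes sorted: "\<And>xs. xs \<in> set R \<Longrightarrow> sorted xs"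
    and init: "frame R lmax \<omega> rr s0"
      "scan_inv R (narr s0 ''gap'') (narr s0 ''ptr'') (dict s0) [0..<nreg s0 ''m'']"
      "nreg s0 ''r'' = 0" "nreg s0 ''w'' = 0" "nreg s0 ''cnt'' = card (dict s0)"
  shows "wp scan s0 (\<lambda>k s. frame R lmax \<omega> rr s \<and>
      nreg s ''l'' = nreg s0 ''l'' \<and> rarr s = rarr s0 \<and>
      nreg s ''cnt'' = card (dict s) \<and> dict s = fold add_first (map set R) (dict s0) \<and>
      scan_inv R (narr s ''gap'') (narr s ''ptr'') (dict s) [0..<nreg s ''w''] \<and>
      k + 10 * (remaining R (narr s ''ptr'') + nreg s ''w'') \<le>
        Suc (10 * (remaining R (narr s0 ''ptr'') + nreg s0 ''m'')))"
proof -
  \<comment> \<open>The invariant below states that the unread active persons, processed from the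
    current dictionary, always lead to this same final set.\<close>
  define goal where "goal = fold add_first (map set R) (dict s0)"
  define I where "I s \<longleftrightarrow> frame R lmax \<omega> rr s \<and>
      nreg s ''l'' = nreg s0 ''l'' \<and> nreg s ''m'' = nreg s0 ''m'' \<and> rarr s = rarr s0 \<and>
      nreg s ''cnt'' = card (dict s) \<and> nreg s ''w'' \<le> nreg s ''r'' \<and> nreg s ''r'' \<le> nreg s ''m'' \<and>
      scan_inv R (narr s ''gap'') (narr s ''ptr'') (dict s)
        ([0..<nreg s ''w''] @ [nreg s ''r''..<nreg s ''m'']) \<and>
      fold (\<lambda>j. add_first (set (R ! (j + narr s ''gap'' j)))) [nreg s ''r''..<nreg s ''m''] (dict s)
        = goal" for s :: "'a state"
  \<comment> \<open>The factor 10 is the cost of the most expensive iteration, the one with an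
    insertion, including its loop test. Such an iteration consumes an element and moves one person
    from the unread to the kept part, so the bracket drops by one.\<close>
  define \<Phi> where "\<Phi> s = 10 * (remaining R (narr s ''ptr'') + nreg s ''w'' +
      (nreg s ''m'' - nreg s ''r''))" for s :: "'a state"
  have I0: "I s0"
    using init scan_inv_fold[OF init(2)] by (simp add: I_def goal_def)
  have body: "wp scan_body s (\<lambda>k s'. I s' \<and> Suc k + \<Phi> s' \<le> \<Phi> s)"
    if "I s" and "nreg s ''r'' < nreg s ''m''" for s
  proof -
    define r w m gap ptr S where
      "r = nreg s ''r''" and "w = nreg s ''w''" and "m = nreg s ''m''" and
      "gap = narr s ''gap''" and "ptr = narr s ''ptr''" and "S = dict s"
    define p where "p = r + gap r"
    note defs = r_def[symmetric] w_def[symmetric] m_def[symmetric] gap_def[symmetric]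
      ptr_def[symmetric] S_def[symmetric]
    have upt: "[r..<m] = r # [Suc r..<m]" using that(2) by (simp add: upt_conv_Cons r_def m_def)
    have I: "frame R lmax \<omega> rr s"
      "nreg s ''l'' = nreg s0 ''l''" "nreg s ''m'' = nreg s0 ''m''" "rarr s = rarr s0"
      "nreg s ''cnt'' = card S" "w \<le> r" "r < m"
      "scan_inv R gap ptr S ([0..<w] @ r # [Suc r..<m])"
      "fold (\<lambda>j. add_first (set (R ! (j + gap j)))) (r # [Suc r..<m]) S = goal"
      using that unfolding I_def defs upt by blast+
    have pn: "p < length R" and ptr: "ptr p \<le> length (R ! p)" and fin: "finite S"
      using I(8) by (auto simp: scan_inv_def p_def)
    have start: "starts R (Suc p) = starts R p + length (R ! p)"
      using pn by (simp add: starts_def length_concat_take_Suc)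
    have el: "concat R ! (starts R p + ptr p) = R ! p ! ptr p" if "ptr p < length (R ! p)"
      using pn nth_concat_take[OF pn that] by (simp add: starts_def)
    show ?thesis
    proof (cases "ptr p < length (R ! p)")
      case True
      note rem = remaining_update[of p R ptr, OF pn True]
      show ?thesis
      proof (cases "R ! p ! ptr p \<in> S")
        case stored: True
        have "scan_inv R gap (ptr(p := Suc (ptr p))) S ([0..<w] @ r # [Suc r..<m])"
          using I(8) True stored by (rule scan_inv_skip)
        then show ?thesis using I True stored rem \<open>r < m\<close>
          unfolding scan_body_def I_def \<Phi>_def
          by (simp add: defs start p_def[symmetric] el frame_def upt_conv_Cons)
      next
        case new: False
        have sp: "sorted (R ! p)" using sorted pn by simp
        note keep = scan_inv_keep[OF I(8) I(6) p_def True new sp]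
        have "fold (\<lambda>j. add_first (set (R ! (j + (gap(w := p - w)) j)))) [Suc r..<m]
            (insert (R ! p ! ptr p) S) = goal"
        proof -
          \<comment> \<open>The write to slot \<open>w\<close> cannot affect unread slots, because
            \<open>w \<le> r\<close>.\<close>
          have "fold (\<lambda>j. add_first (set (R ! (j + (gap(w := p - w)) j)))) [Suc r..<m] T =
              fold (\<lambda>j. add_first (set (R ! (j + gap j)))) [Suc r..<m] T" for T
            by (rule fold_cong) (use \<open>w \<le> r\<close> in auto)
          then show ?thesis using I(9) keep(2) by (simp add: p_def)
        qed
        then show ?thesis using I True new rem \<open>r < m\<close> keep(1) fin
          unfolding scan_body_def I_def \<Phi>_def
          by (simp add: defs start p_def[symmetric] el frame_def del: upt_Suc cong: if_cong)
      qed
    next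
      case False
      then have end_row: "ptr p = length (R ! p)" using ptr by simp
      note drop = scan_inv_drop[OF I(8), folded p_def, OF end_row]
      show ?thesis using I False drop \<open>r < m\<close>
        unfolding scan_body_def I_def \<Phi>_def
        by (simp add: defs start p_def[symmetric] frame_def)
    qed
  qed
  have "wp scan s0 (\<lambda>k s. I s \<and> \<not> beval (NLess (NVar ''r'') (NVar ''m'')) s \<and> k + \<Phi> s \<le> Suc (\<Phi> s0))"
    unfolding scan_def by (rule wp_While[OF body I0]) simp_all
  then show ?thesis
  proof (rule wp_conseq, elim conjE)
    fix k s
    assume I: "I s" and ex: "\<not> beval (NLess (NVar ''r'') (NVar ''m'')) s" and k: "k + \<Phi> s \<le> Suc (\<Phi> s0)"
    have r: "nreg s ''r'' = nreg s ''m''" using I ex unfolding I_def by simp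
    have "dict s = goal" using I unfolding I_def r by simp
    moreover have "scan_inv R (narr s ''gap'') (narr s ''ptr'') (dict s) [0..<nreg s ''w'']"
      using I unfolding I_def r upt_conv_Nil[OF order_refl] append_Nil2 by blast
    moreover have "k + 10 * (remaining R (narr s ''ptr'') + nreg s ''w'') \<le>
        Suc (10 * (remaining R (narr s0 ''ptr'') + nreg s0 ''m''))"
      using k init(3,4) r unfolding \<Phi>_def by simp
    ultimately show "frame R lmax \<omega> rr s \<and>
      nreg s ''l'' = nreg s0 ''l'' \<and> rarr s = rarr s0 \<and>
      nreg s ''cnt'' = card (dict s) \<and> dict s = fold add_first (map set R) (dict s0) \<and>
      scan_inv R (narr s ''gap'') (narr s ''ptr'') (dict s) [0..<nreg s ''w''] \<and>
      k + 10 * (remaining R (narr s ''ptr'') + nreg s ''w'') \<le>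
        Suc (10 * (remaining R (narr s0 ''ptr'') + nreg s0 ''m''))"
      using I unfolding I_def goal_def by blast
  qed
qed

definition rounds :: com where
  "rounds =
     NAssign ''m'' (NVar ''persons'');;
     While (NLess (NVar ''l'') (NVar ''lmax''))
       (NAssign ''l'' (NPlus (NVar ''l'') (NConst 1));;
        NAssign ''r'' (NConst 0);;
        NAssign ''w'' (NConst 0);;
        scan;;
        NAssign ''m'' (NVar ''w'');;
        RPut ''q'' (NVar ''l'')
          (RMinus (ROf (NVar ''cnt''))
            (RTimes (RDivide (RTimes (ROf (NConst 2)) (ROf (NVar ''l''))) (RVar ''epsilon''))
              (RLn (RDivide (ROf (NConst 1)) (RTimes (ROf (NConst 2)) (RVar ''beta'')))))))"

lemma rounds_correct:
  fixes s0 :: "'a::linorder state"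
  assumes sorted: "\<And>xs. xs \<in> set R \<Longrightarrow> sorted xs"
    and init: "frame R lmax \<omega> rr s0" "nreg s0 ''persons'' = length R" "nreg s0 ''l'' = 0"
      "nreg s0 ''cnt'' = 0" "dict s0 = {}" "narr s0 ''gap'' = (\<lambda>_. 0)" "narr s0 ''ptr'' = (\<lambda>_. 0)"
  shows "wp rounds s0 (\<lambda>k s. frame R lmax \<omega> rr s \<and>
      (\<forall>j\<in>{1..lmax}. rarr s ''q'' j = count_query (rr ''epsilon'') (rr ''beta'') j (map set R)) \<and>
      k \<le> 2 + 10 * (length (concat R) + length R + lmax))"
proof -
  define I where "I s \<longleftrightarrow> frame R lmax \<omega> rr s \<and> nreg s ''l'' \<le> lmax \<and>
      (\<forall>j\<in>{1..nreg s ''l''}. rarr s ''q'' j =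
         count_query (rr ''epsilon'') (rr ''beta'') j (map set R)) \<and>
      nreg s ''cnt'' = card (dict s) \<and> dict s = greedy (map set R) (nreg s ''l'') \<and>
      scan_inv R (narr s ''gap'') (narr s ''ptr'') (dict s) [0..<nreg s ''m'']"
    for s :: "'a state"
  \<comment> \<open>The second summand pays for the fixed cost of a round: five assignments and
    updates, the outer test and the last test of the scan.\<close>
  define \<Phi> where "\<Phi> s = 10 * (remaining R (narr s ''ptr'') + nreg s ''m'') +
      10 * (lmax - nreg s ''l'')" for s :: "'a state"
  define s1 where "s1 = s0\<lparr>nreg := (nreg s0)(''m'' := length R)\<rparr>"
  have I1: "I s1"
    using init by (auto simp: I_def s1_def frame_def scan_inv_def comp_def)
  have "remaining R (\<lambda>_. 0) = length (concat R)"
    by (simp add: remaining_def length_concat sum_list_sum_nth atLeast0LessThan)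
  then have \<Phi>1: "\<Phi> s1 = 10 * (length (concat R) + length R + lmax)"
    using init by (simp add: \<Phi>_def s1_def)
  show ?thesis unfolding rounds_def
    apply (simp add: init(2) s1_def[symmetric])
    apply (rule wp_conseq[OF wp_While[where I = I and \<Phi> = \<Phi>]])
    subgoal for s
      apply simp
      apply (rule wp_conseq[OF scan_correct[OF sorted, of R lmax \<omega> rr]])
      apply (auto simp: I_def frame_def)[6]
      apply (auto simp: I_def frame_def \<Phi>_def count_query_def greedy_Suc)
      done
    using I1 \<Phi>1 by (auto simp: I_def frame_def)
qed

section \<open>Valley-shaped sequences and binary search\<close>

definition valley :: "(nat \<Rightarrow> real) \<Rightarrow> nat \<Rightarrow> bool" where
  "valley f m \<longleftrightarrow> (\<forall>j. 1 \<le> j \<and> j + 2 \<le> m \<and> f j \<le> f (j + 1) \<longrightarrow> f (j + 1) \<le> f (j + 2))"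

text \<open>Once the sequence fails to drop, it never drops again. Together with its mirror image
  this lets a comparison of two neighbours decide on which side to look for a minimum.\<close>

lemma valley_right:
  assumes "valley f m" "1 \<le> j" "f j \<le> f (Suc j)" "j \<le> k" "k \<le> m"
  shows "f j \<le> f k"
proof -
  \<comment> \<open>The induction has to carry along that the sequence does not drop at
    \<open>k\<close> either.\<close>
  have "f j \<le> f k \<and> (k < m \<longrightarrow> f k \<le> f (Suc k))"
    using \<open>j \<le> k\<close> \<open>k \<le> m\<close>
  proof (induction k rule: dec_induct)
    case (step k)
    then show ?case using assms(1,2) unfolding valley_def by fastforce
  qed (use assms in auto)
  then show ?thesis ..
qed

text \<open>Going down from \<open>j\<close>: if the sequence failed to drop at \<open>k\<close>, it
  would not drop from \<open>Suc k\<close> up to \<open>Suc j\<close>, against the inequality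
  already known for \<open>Suc k\<close>.\<close>

lemma valley_left:
  assumes "valley f m" "f (Suc j) < f j" "1 \<le> k" "k \<le> j" "j < m"
  shows "f (Suc j) < f k"
  using \<open>k \<le> j\<close> \<open>1 \<le> k\<close>
proof (induction k rule: inc_induct)
  case (step k)
  have "f (Suc k) < f k"
  proof (rule ccontr)
    assume "\<not> f (Suc k) < f k"
    with assms(1) step have "f (Suc k) \<le> f (Suc (Suc k)) \<or> Suc (Suc k) > m"
      unfolding valley_def by (cases "k + 2 \<le> m") auto
    then show False
      using valley_right[OF assms(1), of "Suc k" "Suc j"] step assms by fastforce
  qed
  with step show ?case by simp
qed (use assms in simp)

definition score_exp :: "nexp \<Rightarrow> nexp \<Rightarrow> rexp" where
  "score_exp i j =
     RDivide
       (RMinus (RMinus (RGet ''q'' i) (RTimes (RVar ''t'') (ROf i)))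
               (RMinus (RGet ''q'' j) (RTimes (RVar ''t'') (ROf j))))
       (RPlus (ROf i) (ROf j))"

text \<open>With \<open>a l = q l - t * l\<close>, this is the slope of the line through
  \<open>(-j, a j)\<close> and \<open>(i, a i)\<close>; its minimum over \<open>j\<close> is the GEM
  score of \<open>i\<close>.\<close>

definition slope :: "(nat \<Rightarrow> real) \<Rightarrow> real \<Rightarrow> nat \<Rightarrow> nat \<Rightarrow> real" where
  "slope q t i j = ((q i - t * real i) - (q j - t * real j)) / (real i + real j)"

lemma reval_score_exp [simp]:
  "reval (score_exp i j) s = slope (rarr s ''q'') (rreg s ''t'') (neval i s) (neval j s)"
  by (simp add: score_exp_def slope_def)

definition search :: com where
  "search =
     NAssign ''lo'' (NConst 1);;
     NAssign ''hi'' (NVar ''lmax'');;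
     While (NLess (NVar ''lo'') (NVar ''hi''))
       (NAssign ''mid'' (NHalf (NPlus (NVar ''lo'') (NVar ''hi'')));;
        IfThenElse
          (RLess (score_exp (NVar ''i'') (NPlus (NVar ''mid'') (NConst 1)))
                 (score_exp (NVar ''i'') (NVar ''mid'')))
          (NAssign ''lo'' (NPlus (NVar ''mid'') (NConst 1)))
          (NAssign ''hi'' (NVar ''mid'')))"

text \<open>Some minimiser of \<open>f\<close> over \<open>{1..m}\<close> always stays between
  \<open>lo\<close> and \<open>hi\<close>. The additive 3 consists of the two initial assignments
  and the last loop test.\<close>

lemma search_correct:
  fixes s0 :: "'a state"
  defines "f \<equiv> slope (rarr s0 ''q'') (rreg s0 ''t'') (nreg s0 ''i'')"
  assumes m: "nreg s0 ''lmax'' = m" "1 \<le> m" and valley: "valley f m"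
  shows "wp search s0 (\<lambda>k s. rreg s = rreg s0 \<and> rarr s = rarr s0 \<and> tape s = tape s0 \<and>
      (\<forall>x. x \<notin> {''lo'', ''hi'', ''mid''} \<longrightarrow> nreg s x = nreg s0 x) \<and>
      f (nreg s ''lo'') = Min (f ` {1..m}) \<and> k \<le> 3 + 4 * floor_log (2 * m))"
proof -
  define I where "I s \<longleftrightarrow> rreg s = rreg s0 \<and> rarr s = rarr s0 \<and> tape s = tape s0 \<and>
      (\<forall>x. x \<notin> {''lo'', ''hi'', ''mid''} \<longrightarrow> nreg s x = nreg s0 x) \<and>
      1 \<le> nreg s ''lo'' \<and> nreg s ''lo'' \<le> nreg s ''hi'' \<and> nreg s ''hi'' \<le> m \<and>
      (\<exists>j\<in>{nreg s ''lo''..nreg s ''hi''}. \<forall>k\<in>{1..m}. f j \<le> f k)" for s :: "'a state"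
  \<comment> \<open>Without the doubling an interval of length one, which still needs an iteration,
    would have potential zero.\<close>
  define \<Phi> where "\<Phi> s = 4 * floor_log (2 * (nreg s ''hi'' - nreg s ''lo''))" for s :: "'a state"
  define s1 where "s1 = s0\<lparr>nreg := (nreg s0)(''lo'' := 1, ''hi'' := m)\<rparr>"
  have "Min (f ` {1..m}) \<in> f ` {1..m}" using m by (intro Min_in) auto
  then obtain j where j: "j \<in> {1..m}" "f j = Min (f ` {1..m})" by auto
  then have "\<forall>k\<in>{1..m}. f j \<le> f k" by simp
  with j(1) have "\<exists>j\<in>{1..m}. \<forall>k\<in>{1..m}. f j \<le> f k" by blast
  with m have I1: "I s1" by (simp add: I_def s1_def)
  have \<Phi>1: "\<Phi> s1 \<le> 4 * floor_log (2 * m)"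
    by (auto simp: \<Phi>_def s1_def intro!: floor_log_le_iff)
  have fin: "k + 2 \<le> 3 + 4 * floor_log (2 * m) \<and> f (nreg s ''lo'') = Min (f ` {1..m})"
    if "I s" "\<not> nreg s ''lo'' < nreg s ''hi''" "k + \<Phi> s \<le> Suc (\<Phi> s1)" for k s
  proof
    from that obtain "nreg s ''lo'' \<in> {1..m}" "\<forall>k\<in>{1..m}. f (nreg s ''lo'') \<le> f k"
      unfolding I_def by fastforce
    then show "f (nreg s ''lo'') = Min (f ` {1..m})"
      by (intro Min_eqI[symmetric]) auto
  qed (use that \<Phi>1 in auto)
  have body: "I s' \<and> 4 + \<Phi> s' \<le> \<Phi> s"
    if I: "I s" and less: "nreg s ''lo'' < nreg s ''hi''"
      and mid: "mid = (nreg s ''lo'' + nreg s ''hi'') div 2"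
      and s': "s' = (if f (Suc mid) < f mid
        then s\<lparr>nreg := (nreg s)(''mid'' := mid, ''lo'' := Suc mid)\<rparr>
        else s\<lparr>nreg := (nreg s)(''mid'' := mid, ''hi'' := mid)\<rparr>)" for s s' mid
  proof -
    let ?lo = "nreg s ''lo''" and ?hi = "nreg s ''hi''"
    have b: "1 \<le> ?lo" "?hi \<le> m" using I unfolding I_def by blast+
    have eqs: "rreg s = rreg s0" "rarr s = rarr s0" "tape s = tape s0"
      "\<forall>x. x \<notin> {''lo'', ''hi'', ''mid''} \<longrightarrow> nreg s x = nreg s0 x"
      using I unfolding I_def by blast+
    have bounds: "1 \<le> ?lo" "?lo \<le> mid" "mid < ?hi" "?hi \<le> m" "mid < m" "1 \<le> mid"
      using b less mid by linarith+
    obtain j where j: "j \<in> {?lo..?hi}" "\<forall>k\<in>{1..m}. f j \<le> f k" using I unfolding I_def by blast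
    \<comment> \<open>Halving the length lowers the logarithm by one. This pays for the four units
      of an iteration: loop test, midpoint, branch test and assignment.\<close>
    have half: "4 + 4 * floor_log (2 * d) \<le> \<Phi> s" if "d \<le> (?hi - ?lo) div 2" for d
    proof -
      have "floor_log (2 * d) \<le> floor_log (?hi - ?lo)" using that by (intro floor_log_le_iff) auto
      moreover have "floor_log (2 * (?hi - ?lo)) = Suc (floor_log (?hi - ?lo))"
        using less by (intro floor_log_twice) auto
      ultimately show ?thesis by (simp add: \<Phi>_def)
    qed
    show ?thesis
    proof (cases "f (Suc mid) < f mid")
      case True
      \<comment> \<open>A strict drop after \<open>mid\<close> makes every value up to
        \<open>mid\<close> larger than the one at \<open>Suc mid\<close>.\<close>
      have "\<not> j \<le> mid"
      proof
        assume "j \<le> mid"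
        then have "f (Suc mid) < f j" using valley_left[OF valley True, of j] bounds j by simp
        moreover have "f j \<le> f (Suc mid)" using j(2) bounds by simp
        ultimately show False by simp
      qed
      then have "j \<in> {Suc mid..?hi}" using j(1) by simp
      with j(2) have "\<exists>j\<in>{Suc mid..?hi}. \<forall>k\<in>{1..m}. f j \<le> f k" by blast
      moreover have "?hi - Suc mid \<le> (?hi - ?lo) div 2" using mid by linarith
      note half[OF this]
      ultimately show ?thesis using True s' bounds eqs by (simp add: I_def \<Phi>_def)
    next
      case False
      \<comment> \<open>If the known minimiser lies to the right of \<open>mid\<close>, then
        \<open>mid\<close> is itself a minimiser, since the sequence no longer drops from there
        on.\<close>
      have "\<exists>j\<in>{?lo..mid}. \<forall>k\<in>{1..m}. f j \<le> f k"
      proof (cases "j \<le> mid")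
        case True
        then show ?thesis using j by auto
      next
        case not_le: False
        then have "f mid \<le> f j" using valley_right[OF valley, of mid j] False bounds j by auto
        with j(2) have "\<forall>k\<in>{1..m}. f mid \<le> f k" by (blast intro: order_trans)
        then show ?thesis using bounds by auto
      qed
      moreover have "mid - ?lo \<le> (?hi - ?lo) div 2" using mid by linarith
      note half[OF this]
      ultimately show ?thesis using False s' bounds eqs by (simp add: I_def \<Phi>_def)
    qed
  qed
  have f: "slope (rarr s ''q'') (rreg s ''t'') (nreg s ''i'') = f" if "I s" for s
    using that by (simp add: I_def f_def)
  have I_frame: "rreg s = rreg s0 \<and> rarr s = rarr s0 \<and> tape s = tape s0 \<and>
      (\<forall>x. x \<notin> {''lo'', ''hi'', ''mid''} \<longrightarrow> nreg s x = nreg s0 x)" if "I s" for s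
    using that unfolding I_def by blast
  show ?thesis unfolding search_def
    apply (simp add: m(1) s1_def[symmetric])
    apply (rule wp_conseq[OF wp_While[where I = I and \<Phi> = \<Phi>]])
    subgoal for s
      using body[of s "(nreg s ''lo'' + nreg s ''hi'') div 2", OF _ _ refl refl] f[of s]
      by (auto simp: fun_upd_twist split: if_splits)
    subgoal using I1 by (simp add: s1_def)
    subgoal for k s using fin[of s k] I_frame[of s] by (simp add: s1_def)
    done
qed

section \<open>Computing the weights and drawing the output\<close>

definition weights :: com where
  "weights =
     NAssign ''i'' (NConst 0);;
     RAssign ''t'' (RTimes (RDivide (ROf (NConst 2)) (RDivide (RVar ''epsilon'') (ROf (NConst 2))))
       (RLn (RDivide (ROf (NVar ''lmax'')) (RVar ''beta''))));;
     While (NLess (NVar ''i'') (NVar ''lmax''))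
       (NAssign ''i'' (NPlus (NVar ''i'') (NConst 1));;
        search;;
        RPut ''weight'' (NVar ''i'')
          (RExp (RDivide
            (RTimes (RDivide (RVar ''epsilon'') (ROf (NConst 2)))
                    (score_exp (NVar ''i'') (NVar ''lo'')))
            (ROf (NConst 2))));;
        RAssign ''total'' (RPlus (RVar ''total'') (RGet ''weight'' (NVar ''i''))))"

lemma weights_correct:
  fixes s0 :: "'a state" and \<epsilon> \<beta> :: real and m :: nat
  defines "f \<equiv> slope (rarr s0 ''q'') (2 / (\<epsilon> / 2) * ln (real m / \<beta>))"
  defines "w \<equiv> \<lambda>i. exp (\<epsilon> / 2 * Min (f i ` {1..m}) / 2)"
  assumes init: "nreg s0 ''lmax'' = m" "rreg s0 ''epsilon'' = \<epsilon>" "rreg s0 ''beta'' = \<beta>"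
      "rreg s0 ''total'' = 0"
    and m: "1 \<le> m" and valley: "\<And>i. 1 \<le> i \<Longrightarrow> i \<le> m \<Longrightarrow> valley (f i) m"
  shows "wp weights s0 (\<lambda>k s. nreg s ''lmax'' = m \<and> rreg s ''epsilon'' = \<epsilon> \<and> tape s = tape s0 \<and>
      rarr s ''q'' = rarr s0 ''q'' \<and> (\<forall>i\<in>{1..m}. rarr s ''weight'' i = w i) \<and>
      rreg s ''total'' = (\<Sum>i\<in>{1..m}. w i) \<and> k \<le> 3 + m * (8 + 4 * floor_log (2 * m)))"
proof -
  define t where "t = 2 / (\<epsilon> / 2) * ln (real m / \<beta>)"
  define I where "I s \<longleftrightarrow> nreg s ''lmax'' = m \<and> rreg s ''epsilon'' = \<epsilon> \<and> rreg s ''t'' = t \<and>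
      tape s = tape s0 \<and> rarr s ''q'' = rarr s0 ''q'' \<and> nreg s ''i'' \<le> m \<and>
      (\<forall>i\<in>{1..nreg s ''i''}. rarr s ''weight'' i = w i) \<and>
      rreg s ''total'' = (\<Sum>i\<in>{1..nreg s ''i''}. w i)" for s :: "'a state"
  \<comment> \<open>One search costs at most \<open>3 + 4 * floor_log (2 * m)\<close>. The loop
    test, the increment of the index and the two assignments after the search add four units, which
    the charge covers.\<close>
  define \<Phi> where "\<Phi> s = (m - nreg s ''i'') * (8 + 4 * floor_log (2 * m))" for s :: "'a state"
  define s1 where "s1 = s0\<lparr>nreg := (nreg s0)(''i'' := 0), rreg := (rreg s0)(''t'' := t)\<rparr>"
  have I1: "I s1" and \<Phi>1: "\<Phi> s1 = m * (8 + 4 * floor_log (2 * m))"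
    using init by (simp_all add: I_def s1_def \<Phi>_def)
  show ?thesis unfolding weights_def
    apply (simp add: init(1-3) t_def[symmetric] s1_def[symmetric])
    apply (rule wp_conseq[OF wp_While[where I = I and \<Phi> = \<Phi>]])
    subgoal for s
    proof -
      assume I: "I s" and "beval (NLess (NVar ''i'') (NVar ''lmax'')) s"
      then have less: "nreg s ''i'' < m" by (simp add: I_def)
      define s' where "s' = s\<lparr>nreg := (nreg s)(''i'' := Suc (nreg s ''i''))\<rparr>"
      define g where "g = floor_log (2 * m)"
      have f: "slope (rarr s' ''q'') (rreg s' ''t'') (nreg s' ''i'') = f (Suc (nreg s ''i''))"
        using I by (simp add: s'_def I_def f_def t_def)
      have lm: "nreg s' ''lmax'' = m" using I by (simp add: s'_def I_def)
      have "valley (f (Suc (nreg s ''i''))) m" using less by (intro valley) auto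
      from search_correct[OF lm m, unfolded f, OF this]
      have *: "wp search s' (\<lambda>k s. rreg s = rreg s' \<and> rarr s = rarr s' \<and> tape s = tape s' \<and>
          (\<forall>x. x \<notin> {''lo'', ''hi'', ''mid''} \<longrightarrow> nreg s x = nreg s' x) \<and>
          f (nreg s' ''i'') (nreg s ''lo'') = Min (f (nreg s' ''i'') ` {1..m}) \<and> k \<le> 3 + 4 * g)"
        by (simp add: s'_def g_def)
      have pot: "8 + 4 * g + (m - Suc (nreg s ''i'')) * (8 + 4 * g) = \<Phi> s"
        using less unfolding \<Phi>_def g_def[symmetric]
        by (simp add: Suc_diff_Suc[symmetric])
      have step: "I s''' \<and> Suc (Suc k + 2) + \<Phi> s''' \<le> \<Phi> s"
        if r: "rreg s'' = rreg s'" "rarr s'' = rarr s'" "tape s'' = tape s'"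
          and n: "\<forall>x. x \<notin> {''lo'', ''hi'', ''mid''} \<longrightarrow> nreg s'' x = nreg s' x"
          and min: "f (nreg s' ''i'') (nreg s'' ''lo'') = Min (f (nreg s' ''i'') ` {1..m})"
          and k: "k \<le> 3 + 4 * g"
          and s''': "s''' = s''\<lparr>rarr := (rarr s'')(''weight'' := (rarr s'' ''weight'')(nreg s'' ''i'' :=
              w (nreg s'' ''i''))), rreg := (rreg s'')(''total'' := rreg s'' ''total'' + w (nreg s'' ''i''))\<rparr>"
        for k s'' s'''
      proof -
        have "nreg s'' ''i'' = Suc (nreg s ''i'')" "nreg s'' ''lmax'' = m"
          using n lm by (simp_all add: s'_def)
        then show ?thesis
          using I less r k pot unfolding s''' by (auto simp: I_def \<Phi>_def s'_def g_def[symmetric] le_Suc_eq)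
      qed
      show ?thesis
        apply (simp add: s'_def[symmetric])
        apply (rule wp_conseq[OF *])
        apply (elim conjE)
        subgoal premises p for k s''
        proof -
          have i: "nreg s'' ''i'' = nreg s' ''i''" using p(4) by simp
          have sl: "slope (rarr s' ''q'') (rreg s' ''t'') (nreg s' ''i'') (nreg s'' ''lo'')
              = Min (f (nreg s' ''i'') ` {1..m})"
            using p(5) f by (simp add: s'_def)
          have eps: "rreg s' ''epsilon'' = \<epsilon>" using I by (simp add: s'_def I_def)
          show ?thesis
            using step[OF p refl] by (simp add: p(1,2) i sl eps w_def)
        qed
        done
    qed
    subgoal using I1 by (simp add: s1_def t_def)
    subgoal for k s using \<Phi>1 by (auto simp: I_def s1_def t_def)
    done
qed

text \<open>Inverse transform sampling for the distribution on \<open>{1..m}\<close> proportional to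
  \<open>w\<close>. The disjunct \<open>l = m\<close> settles values \<open>u > 1\<close>, which an
  arbitrary tape may contain.\<close>

definition pick :: "nat \<Rightarrow> (nat \<Rightarrow> real) \<Rightarrow> real \<Rightarrow> nat" where
  "pick m w u = (LEAST l. 1 \<le> l \<and> (l = m \<or> \<not> sum w {1..l} < u * sum w {1..m}))"

text \<open>The inverse of the Laplace distribution function on the open unit interval; the
  remaining arguments occur with probability zero.\<close>

definition laplace_quantile :: "real \<Rightarrow> real \<Rightarrow> real" where
  "laplace_quantile b v = (if v < 1 / 2 then b * ln (2 * v) else - (b * ln (2 * (1 - v))))"

definition draw :: com where
  "draw =
     Sample ''u'';;
     NAssign ''l'' (NConst 1);;
     RAssign ''acc'' (RGet ''weight'' (NVar ''l''));;
     While (BAnd (NLess (NVar ''l'') (NVar ''lmax''))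
                 (RLess (RVar ''acc'') (RTimes (RVar ''u'') (RVar ''total''))))
       (NAssign ''l'' (NPlus (NVar ''l'') (NConst 1));;
        RAssign ''acc'' (RPlus (RVar ''acc'') (RGet ''weight'' (NVar ''l''))));;
     Sample ''v'';;
     RAssign ''b'' (RDivide (RTimes (ROf (NConst 2)) (ROf (NVar ''l''))) (RVar ''epsilon''));;
     IfThenElse (RLess (RVar ''v'') (RDivide (ROf (NConst 1)) (ROf (NConst 2))))
       (RAssign ''nu'' (RPlus (RGet ''q'' (NVar ''l''))
         (RTimes (RVar ''b'') (RLn (RTimes (ROf (NConst 2)) (RVar ''v''))))))
       (RAssign ''nu'' (RMinus (RGet ''q'' (NVar ''l''))
         (RTimes (RVar ''b'')
           (RLn (RTimes (ROf (NConst 2)) (RMinus (ROf (NConst 1)) (RVar ''v'')))))))"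

lemma draw_correct:
  fixes s0 :: "'a state"
  assumes init: "nreg s0 ''lmax'' = m" "rreg s0 ''epsilon'' = \<epsilon>" "\<And>i. i \<in> {1..m} \<Longrightarrow> rarr s0 ''weight'' i = w i"
      "rreg s0 ''total'' = sum w {1..m}" "\<And>i. i \<in> {1..m} \<Longrightarrow> rarr s0 ''q'' i = q i"
    and m: "1 \<le> m"
  shows "wp draw s0 (\<lambda>k s. k \<le> 10 + 4 * m \<and>
      result s = (let l = pick m w (tape s0 !! 0)
        in (l, q l + laplace_quantile (2 * real l / \<epsilon>) (tape s0 !! 1))))"
proof -
  let ?u = "tape s0 !! 0"
  \<comment> \<open>By the last conjunct no index passed so far meets the stopping condition, so the
    loop ends at the least index that does, as in \<open>pick\<close>.\<close>
  define I where "I s \<longleftrightarrow> nreg s ''lmax'' = m \<and> rreg s ''epsilon'' = \<epsilon> \<and>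
      rreg s ''u'' = ?u \<and> rreg s ''total'' = sum w {1..m} \<and>
      tape s = stl (tape s0) \<and> rarr s = rarr s0 \<and>
      1 \<le> nreg s ''l'' \<and> nreg s ''l'' \<le> m \<and> rreg s ''acc'' = sum w {1..nreg s ''l''} \<and>
      (\<forall>k\<in>{1..<nreg s ''l''}. sum w {1..k} < ?u * sum w {1..m})" for s :: "'a state"
  define \<Phi> where "\<Phi> s = 4 * (m - nreg s ''l'')" for s :: "'a state"
  define s1 where "s1 = s0\<lparr>tape := stl (tape s0), nreg := (nreg s0)(''l'' := 1),
    rreg := (rreg s0)(''u'' := ?u, ''acc'' := w 1)\<rparr>"
  have w1: "rarr s0 ''weight'' (Suc 0) = w (Suc 0)" using init(3)[of 1] m by simp
  have I1: "I s1" and \<Phi>1: "\<Phi> s1 \<le> 4 * m"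
    using init m by (simp_all add: I_def s1_def \<Phi>_def)
  show ?thesis unfolding draw_def
    apply (simp add: w1)
    apply (rule wp_conseq[OF wp_While[where I = I and \<Phi> = \<Phi>]])
    subgoal for s
      using init(3)[of "Suc (nreg s ''l'')"]
      by (auto simp: I_def \<Phi>_def less_Suc_eq)
    subgoal using I1 by (simp add: s1_def)
    subgoal premises p for k s
    proof -
      have I: "I s" and ex: "nreg s ''l'' = m \<or> \<not> rreg s ''acc'' < ?u * sum w {1..m}"
        using p by (auto simp: I_def)
      have pick: "pick m w ?u = nreg s ''l''"
        unfolding pick_def
      proof (rule Least_equality)
        show "1 \<le> nreg s ''l'' \<and> (nreg s ''l'' = m \<or> \<not> sum w {1..nreg s ''l''} < ?u * sum w {1..m})"
          using I ex by (auto simp: I_def)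
      next
        fix l assume l: "1 \<le> l \<and> (l = m \<or> \<not> sum w {1..l} < ?u * sum w {1..m})"
        show "nreg s ''l'' \<le> l"
        proof (rule ccontr)
          assume "\<not> nreg s ''l'' \<le> l"
          with l I show False by (auto simp: I_def)
        qed
      qed
      have q: "rarr s ''q'' (nreg s ''l'') = q (nreg s ''l'')"
        using I init(5) by (simp add: I_def)
      have "k + 4 * (m - nreg s ''l'') \<le> Suc (4 * (m - Suc 0))" using p by (simp add: \<Phi>_def)
      then have k: "k \<le> Suc (4 * m)" by linarith
      have "tape s = stl (tape s0)" "rreg s ''epsilon'' = \<epsilon>" using I by (simp_all add: I_def)
      then show ?thesis using q k pick
        by (simp add: Let_def result_def laplace_quantile_def)
    qed
    done
qed

section \<open>Valley shape of the slopes and correctness of the whole program\<close>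

lemma valley_cong:
  assumes "valley f m" "\<And>j. j \<in> {1..m} \<Longrightarrow> g j = f j"
  shows "valley g m"
  unfolding valley_def
proof (intro allI impI)
  fix j assume j: "1 \<le> j \<and> j + 2 \<le> m \<and> g j \<le> g (j + 1)"
  then have "g j = f j" "g (j + 1) = f (j + 1)" "g (j + 2) = f (j + 2)"
    by (auto intro!: assms(2))
  with assms(1) j show "g (j + 1) \<le> g (j + 2)" unfolding valley_def by metis
qed

text \<open>Let \<open>x\<close>, \<open>y\<close>, \<open>z\<close> be consecutive numerators, over
  \<open>n\<close>, \<open>n + 1\<close>, \<open>n + 2\<close>. The terms linear in \<open>t\<close>
  cancel in second differences, so concavity gives \<open>z \<ge> 2 * y - x\<close>. With
  \<open>x * (n + 1) \<le> y * n\<close> this yields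
  \<open>z * (n + 1) \<ge> y * (n + 2)\<close>.\<close>

lemma valley_slope:
  assumes "\<And>j. q (j + 2) + q j \<le> 2 * q (j + 1)" "1 \<le> i"
  shows "valley (slope q t i) m"
  unfolding valley_def
proof (intro allI impI)
  fix j assume j: "1 \<le> j \<and> j + 2 \<le> m \<and> slope q t i j \<le> slope q t i (j + 1)"
  define n x y z where "n = real i + real j" and "x = (q i - t * real i) - (q j - t * real j)"
    and "y = (q i - t * real i) - (q (j + 1) - t * real (j + 1))"
    and "z = (q i - t * real i) - (q (j + 2) - t * real (j + 2))"
  have n: "n > 0" using assms(2) by (simp add: n_def)
  have s: "slope q t i j = x / n" "slope q t i (j + 1) = y / (n + 1)" "slope q t i (j + 2) = z / (n + 2)"
    by (simp_all add: slope_def n_def x_def y_def z_def add_ac)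
  have "2 * y - x \<le> z" using assms(1)[of j] by (simp add: x_def y_def z_def algebra_simps)
  then have "(2 * y - x) * (n + 1) \<le> z * (n + 1)" using n by (intro mult_right_mono) auto
  moreover have "x * (n + 1) \<le> y * n" using j n unfolding s by (simp add: field_simps)
  ultimately have "y * (n + 2) \<le> z * (n + 1)" by (simp add: algebra_simps)
  then show "slope q t i (j + 1) \<le> slope q t i (j + 2)" unfolding s using n by (simp add: field_simps)
qed

text \<open>The subtracted noise bound is linear in the level, so the greedy cardinalities pass on
  their concavity.\<close>

lemma count_query_concave:
  assumes "D \<in> datasets"
  shows "count_query \<epsilon> \<beta> (j + 2) D + count_query \<epsilon> \<beta> j D \<le> 2 * count_query \<epsilon> \<beta> (j + 1) D"
proof -
  have "real (card (greedy D (j + 2))) + real (card (greedy D j)) \<le> 2 * real (card (greedy D (j + 1)))"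
    using card_greedy_concave[OF assms, of j] by simp
  moreover have "2 * real (j + 2) / \<epsilon> * L + 2 * real j / \<epsilon> * L = 2 * (2 * real (j + 1) / \<epsilon> * L)" for L
    by (simp add: algebra_simps add_divide_distrib)
  ultimately show ?thesis unfolding count_query_def by (smt (verit))
qed

lemma gem_score_eq_slope:
  "gem_score D m q real \<epsilon> \<beta> i = Min (slope (\<lambda>j. q j D) (2 / \<epsilon> * ln (real m / \<beta>)) i ` {1..m})"
  by (simp add: gem_score_def slope_def)

lemma map_set_rows: "D \<in> datasets \<Longrightarrow> map set (rows D) = filter (\<lambda>u. u \<noteq> {}) D"
  by (auto simp: rows_def datasets_def intro!: map_idI)

lemma greedy_rows: "D \<in> datasets \<Longrightarrow> greedy (map set (rows D)) l = greedy D l"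
  by (induction l) (simp_all add: greedy_Suc map_set_rows fold_add_first_filter)

lemma rows_length: "D \<in> datasets \<Longrightarrow>
    length (concat (rows D)) = dataset_size D \<and> length (rows D) \<le> dataset_size D"
proof (induction D)
  case (Cons u D)
  then have "finite u" "D \<in> datasets" by (auto simp: datasets_def)
  with Cons.IH have IH: "length (concat (rows D)) = dataset_size D" "length (rows D) \<le> dataset_size D"
    by auto
  show ?case
  proof (cases "u = {}")
    case False
    then have "1 \<le> card u" using \<open>finite u\<close> by (simp add: Suc_le_eq card_gt_0_iff)
    with IH False show ?thesis by (simp add: rows_def dataset_size_def)
  qed (use IH in \<open>simp add: rows_def dataset_size_def\<close>)
qed (simp add: rows_def dataset_size_def)

definition program :: com where
  "program = rounds;; weights;; draw"

definition gem_weight :: "'a::linorder set list \<Rightarrow> nat \<Rightarrow> real \<Rightarrow> real \<Rightarrow> nat \<Rightarrow> real" where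
  "gem_weight D m \<epsilon> \<beta> i = exp (\<epsilon> / 2 * gem_score D m (count_query \<epsilon> \<beta>) real (\<epsilon> / 2) \<beta> i / 2)"

text \<open>The result is a function of the first two tape entries, whereas the step bound is the
  same for all tapes.\<close>

lemma program_correct:
  assumes D: "D \<in> datasets" and m: "1 \<le> m"
  shows "wp program (init_state m \<epsilon> \<beta> D \<omega>) (\<lambda>k s.
      result s = (let l = pick m (gem_weight D m \<epsilon> \<beta>) (\<omega> !! 0)
        in (l, count_query \<epsilon> \<beta> l D + laplace_quantile (2 * real l / \<epsilon>) (\<omega> !! 1))) \<and>
      k \<le> 15 + 20 * dataset_size D + m * (22 + 4 * floor_log (2 * m)))"
proof -
  let ?R = "rows D" and ?s0 = "init_state m \<epsilon> \<beta> D \<omega>"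
  let ?rr = "(\<lambda>_. 0 :: real)(''epsilon'' := \<epsilon>, ''beta'' := \<beta>)"
  let ?q = "\<lambda>j. count_query \<epsilon> \<beta> j D"
  have sorted: "\<And>xs. xs \<in> set ?R \<Longrightarrow> sorted xs" by (auto simp: rows_def)
  have q: "count_query \<epsilon> \<beta> j (map set ?R) = ?q j" for j
    using greedy_rows[OF D] by (simp add: count_query_def)
  have 1: "wp rounds ?s0 (\<lambda>k s. frame ?R m \<omega> ?rr s \<and> (\<forall>j\<in>{1..m}. rarr s ''q'' j = ?q j) \<and>
      k \<le> 2 + 10 * (length (concat ?R) + length ?R + m))"
    by (rule wp_conseq[OF rounds_correct[OF sorted, of ?R m \<omega> ?rr]])
       (auto simp: init_state_def frame_def starts_def fun_eq_iff q)
  have 2: "wp weights s (\<lambda>k s'. nreg s' ''lmax'' = m \<and> rreg s' ''epsilon'' = \<epsilon> \<and> tape s' = \<omega> \<and>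
      (\<forall>j\<in>{1..m}. rarr s' ''q'' j = ?q j) \<and>
      (\<forall>i\<in>{1..m}. rarr s' ''weight'' i = gem_weight D m \<epsilon> \<beta> i) \<and>
      rreg s' ''total'' = sum (gem_weight D m \<epsilon> \<beta>) {1..m} \<and> k \<le> 3 + m * (8 + 4 * floor_log (2 * m)))"
    if fr: "frame ?R m \<omega> ?rr s" and qs: "\<forall>j\<in>{1..m}. rarr s ''q'' j = ?q j" for s
  proof -
    let ?t = "2 / (\<epsilon> / 2) * ln (real m / \<beta>)"
    have sl: "slope (rarr s ''q'') ?t i j = slope ?q ?t i j" if "i \<in> {1..m}" "j \<in> {1..m}" for i j
      using qs that by (simp add: slope_def)
    have v: "valley (slope (rarr s ''q'') ?t i) m" if "1 \<le> i" "i \<le> m" for i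
    proof -
      have "valley (slope ?q ?t i) m"
        using count_query_concave[OF D] that(1) by (rule valley_slope)
      then show ?thesis by (rule valley_cong) (use sl[of i] that in simp)
    qed
    have w: "exp (\<epsilon> / 2 * Min (slope (rarr s ''q'') ?t i ` {1..m}) / 2) = gem_weight D m \<epsilon> \<beta> i"
      if "i \<in> {1..m}" for i
    proof -
      have "slope (rarr s ''q'') ?t i ` {1..m} = slope ?q ?t i ` {1..m}"
        using sl[OF that] by (rule image_cong[OF refl])
      then show ?thesis by (simp add: gem_weight_def gem_score_eq_slope)
    qed
    show ?thesis
      by (rule wp_conseq[OF weights_correct[of s m \<epsilon> \<beta>]])
         (use fr qs v m w in \<open>auto simp: frame_def intro!: sum.cong\<close>)
  qed
  have 3: "wp draw s (\<lambda>k s'. k \<le> 10 + 4 * m \<and>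
      result s' = (let l = pick m (gem_weight D m \<epsilon> \<beta>) (\<omega> !! 0)
        in (l, ?q l + laplace_quantile (2 * real l / \<epsilon>) (\<omega> !! 1))))"
    if "nreg s ''lmax'' = m" "rreg s ''epsilon'' = \<epsilon>" "tape s = \<omega>"
      "\<forall>j\<in>{1..m}. rarr s ''q'' j = ?q j"
      "\<forall>i\<in>{1..m}. rarr s ''weight'' i = gem_weight D m \<epsilon> \<beta> i"
      "rreg s ''total'' = sum (gem_weight D m \<epsilon> \<beta>) {1..m}" for s
    using draw_correct[of s m \<epsilon> "gem_weight D m \<epsilon> \<beta>" ?q] that m by simp
  have size: "length (concat ?R) = dataset_size D" "length ?R \<le> dataset_size D"
    using rows_length[OF D] by auto
  show ?thesis unfolding program_def wp_Seq
  proof (rule wp_conseq[OF 1], elim conjE, goal_cases)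
    case a: (1 k1 s1)
    show ?case
    proof (rule wp_conseq[OF 2[OF a(1,2)]], elim conjE, goal_cases)
      case b: (1 k2 s2)
      show ?case
      proof (rule wp_conseq[OF 3[OF b(1-6)]], elim conjE, goal_cases)
        case c: (1 k3 s3)
        \<comment> \<open>Stored rows are nonempty, so \<open>dataset_size D\<close> bounds the
          number of rows as well as the number of elements.\<close>
        have "k1 + (k2 + k3) \<le> 2 + 10 * (dataset_size D + dataset_size D + m)
            + (3 + m * (8 + 4 * floor_log (2 * m)) + (10 + 4 * m))"
        proof -
          have "10 * (length (concat ?R) + length ?R + m) \<le> 10 * (dataset_size D + dataset_size D + m)"
            using size by simp
          with a(3) have "k1 \<le> 2 + 10 * (dataset_size D + dataset_size D + m)" by linarith
          from add_mono[OF this add_mono[OF b(7) c(1)]] show ?thesis by (simp only: add.assoc)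
        qed
        also have "\<dots> = 15 + 20 * dataset_size D + m * (22 + 4 * floor_log (2 * m))"
          by (simp add: algebra_simps)
        finally show ?case using c(2) by blast
      qed
    qed
  qed
qed

section \<open>Laplace and index sampling\<close>

lemma sets_laplace [simp, measurable_cong]: "sets (laplace b) = sets borel"
  by (simp add: laplace_def)

lemma space_laplace [simp]: "space (laplace b) = UNIV"
  by (simp add: laplace_def)

lemma emeasure_laplace:
  "A \<in> sets borel \<Longrightarrow> emeasure (laplace b) A =
    (\<integral>\<^sup>+x. ennreal (1 / (2 * b) * exp (- \<bar>x\<bar> / b)) * indicator A x \<partial>lborel)"
  unfolding laplace_def by (subst emeasure_density) auto

lemma emeasure_laplace_atLeast:
  assumes "b > 0" "0 \<le> x"
  shows "emeasure (laplace b) {x..} = ennreal (exp (- x / b) / 2)"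
proof -
  have "emeasure (laplace b) {x..} =
      (\<integral>\<^sup>+y. ennreal (1 / (2 * b) * exp (- y / b)) * indicator {x..} y \<partial>lborel)"
    unfolding emeasure_laplace[OF atLeast_borel]
    by (intro nn_integral_cong) (use assms in \<open>auto simp: indicator_def\<close>)
  also have "\<dots> = 0 - (- (exp (- x / b) / 2))"
  proof (rule nn_integral_FTC_atLeast)
    show "((\<lambda>y. - (exp (- y / b) / 2)) \<longlongrightarrow> 0) at_top"
      using assms by real_asymp
  qed (use assms in \<open>auto intro!: derivative_eq_intros simp: field_simps\<close>)
  finally show ?thesis by simp
qed

text \<open>The density is even. This turns the formula for upper tails into the one for lower
  tails.\<close>

lemma emeasure_laplace_uminus:
  assumes "A \<in> sets borel"
  shows "emeasure (laplace b) (uminus -` A) = emeasure (laplace b) A"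
proof -
  have "uminus -` A \<in> sets (borel :: real measure)"
    using measurable_sets[of uminus borel borel A] assms by simp
  then show ?thesis
    unfolding emeasure_laplace[OF assms]
    by (subst nn_integral_real_affine[where c = "-1" and t = 0])
       (use assms in \<open>auto simp: emeasure_laplace indicator_def intro!: nn_integral_cong\<close>)
qed

lemma emeasure_laplace_atMost:
  assumes "b > 0" "x \<le> 0"
  shows "emeasure (laplace b) {..x} = ennreal (exp (x / b) / 2)"
proof -
  have "uminus -` {- x..} = {..x}" by auto
  then show ?thesis
    using emeasure_laplace_uminus[of "{- x..}" b] emeasure_laplace_atLeast[of b "- x"] assms by simp
qed

lemma emeasure_laplace_greaterThan:
  "emeasure (laplace b) {x<..} = emeasure (laplace b) {x..}"
  unfolding emeasure_laplace[OF greaterThan_borel] emeasure_laplace[OF atLeast_borel]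
  by (rule nn_integral_cong_AE, rule eventually_mono[OF AE_lborel_singleton[of x]])
     (auto simp: indicator_def)

lemma prob_space_laplace:
  assumes "b > 0"
  shows "prob_space (laplace b)"
proof
  have "emeasure (laplace b) ({..0} \<union> {0<..}) =
      emeasure (laplace b) {..0} + emeasure (laplace b) {0<..}"
    by (rule plus_emeasure[symmetric]) auto
  also have "{..0} \<union> {0<..} = (UNIV :: real set)" by auto
  also have "emeasure (laplace b) {..0} + emeasure (laplace b) {0<..} = ennreal (1 / 2) + ennreal (1 / 2)"
    using assms by (simp add: emeasure_laplace_greaterThan emeasure_laplace_atLeast
      emeasure_laplace_atMost)
  also have "\<dots> = ennreal (1 / 2 + 1 / 2)" by (rule ennreal_plus[symmetric]) auto
  finally show "emeasure (laplace b) (space (laplace b)) = 1" by simp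
qed

definition laplace_cdf :: "real \<Rightarrow> real \<Rightarrow> real" where
  "laplace_cdf b x = (if x \<le> 0 then exp (x / b) / 2 else 1 - exp (- x / b) / 2)"

lemma measure_laplace_atMost:
  assumes "b > 0"
  shows "measure (laplace b) {..x} = laplace_cdf b x"
proof (cases "x \<le> 0")
  case True
  with emeasure_laplace_atMost[OF assms] show ?thesis
    by (simp add: measure_def laplace_cdf_def)
next
  case False
  interpret prob_space "laplace b" using assms by (rule prob_space_laplace)
  have "measure (laplace b) {x<..} = exp (- x / b) / 2"
    using emeasure_laplace_atLeast[OF assms, of x] False
    by (simp add: measure_def emeasure_laplace_greaterThan)
  moreover have "measure (laplace b) (space (laplace b) - {x<..}) = 1 - measure (laplace b) {x<..}"
    by (rule prob_compl) simp
  moreover have "space (laplace b) - {x<..} = {..x}" by auto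
  ultimately show ?thesis using False by (simp add: laplace_cdf_def)
qed

lemma measure_laplace_atLeast:
  assumes "b > 0"
  shows "measure (laplace b) {x..} = laplace_cdf b (- x)"
proof -
  have "uminus -` {..- x} = {x..}" by auto
  then show ?thesis
    using emeasure_laplace_uminus[of "{..- x}" b] measure_laplace_atMost[OF assms, of "- x"]
    by (simp add: measure_def)
qed

section \<open>Inverse transform sampling from uniform variables\<close>

abbreviation uniform :: "real measure" where
  "uniform \<equiv> uniform_measure lborel {0..1}"

lemma prob_space_uniform: "prob_space uniform"
  by (rule prob_space_uniform_measure) auto

lemma AE_uniform: "AE u in uniform. 0 < u \<and> u < 1"
proof (subst AE_uniform_measure)
  show "AE u in lborel. u \<in> {0..1::real} \<longrightarrow> 0 < u \<and> u < 1"
    using AE_lborel_singleton[of "0::real"] AE_lborel_singleton[of "1::real"]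
    by eventually_elim auto
qed auto

lemma measure_uniform_Ioc:
  assumes "0 \<le> a" "a \<le> b" "b \<le> 1"
  shows "emeasure uniform {a<..b} = ennreal (b - a)"
proof -
  have "{0..1} \<inter> {a<..b} = {a<..b}" using assms by auto
  then show ?thesis using assms by (simp add: emeasure_uniform_measure divide_ennreal_def)
qed

text \<open>Where the branches of quantile and distribution function match, both sides are
  rearrangements of each other. For \<open>u < 1 / 2\<close> and \<open>x > 0\<close> both sides
  hold; for \<open>u \<ge> 1 / 2\<close> and \<open>x < 0\<close> both fail.\<close>

lemma laplace_quantile_le_iff:
  assumes "b > 0" "0 < u" "u < 1"
  shows "laplace_quantile b u \<le> x \<longleftrightarrow> u \<le> laplace_cdf b x"
proof (cases "u < 1 / 2")
  case True
  then have "laplace_quantile b u \<le> x \<longleftrightarrow> 2 * u \<le> exp (x / b)"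
  proof -
    have "laplace_quantile b u \<le> x \<longleftrightarrow> ln (2 * u) \<le> x / b"
      using True assms by (simp add: laplace_quantile_def pos_le_divide_eq mult.commute)
    also have "\<dots> \<longleftrightarrow> exp (ln (2 * u)) \<le> exp (x / b)" by simp
    finally show ?thesis using assms by simp
  qed
  moreover have "2 * u \<le> exp (x / b)" if "0 < x"
  proof -
    have "1 < exp (x / b)" using that assms by simp
    with True show ?thesis by linarith
  qed
  moreover have "u \<le> 1 - exp (- x / b) / 2" if "0 < x"
  proof -
    have "exp (- x / b) < 1" using that assms by simp
    with True show ?thesis by linarith
  qed
  ultimately show ?thesis by (auto simp: laplace_cdf_def)
next
  case False
  have "laplace_quantile b u \<le> x \<longleftrightarrow> exp (- x / b) \<le> 2 * (1 - u)"
  proof -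
    have "laplace_quantile b u \<le> x \<longleftrightarrow> - x / b \<le> ln (2 * (1 - u))"
    proof -
      have "laplace_quantile b u \<le> x \<longleftrightarrow> - x \<le> ln (2 * (1 - u)) * b"
        using False by (simp add: laplace_quantile_def mult.commute minus_le_iff)
      then show ?thesis using assms by (simp only: pos_divide_le_eq)
    qed
    also have "\<dots> \<longleftrightarrow> exp (- x / b) \<le> 2 * (1 - u)"
      using assms by (simp add: ln_ge_iff)
    finally show ?thesis .
  qed
  moreover have "exp (- x / b) \<le> 2 * (1 - u) \<longleftrightarrow> u \<le> exp (x / b) / 2" if x: "x \<le> 0"
  proof -
    consider "x = 0" | "1 < exp (- x / b)" "exp (x / b) < 1"
      using x assms by (cases "x = 0") (auto simp: divide_less_0_iff)
    then show ?thesis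
    proof cases
      case 2
      moreover have "2 * (1 - u) < p" if "1 < p" for p using False that by simp
      moreover have "q / 2 < u" if "q < 1" for q using False that by simp
      ultimately show ?thesis by (meson not_le)
    qed auto
  qed
  ultimately show ?thesis by (auto simp: laplace_cdf_def)
qed

lemma borel_measurable_laplace_quantile [measurable]:
  assumes [measurable]: "f \<in> borel_measurable M" "g \<in> borel_measurable M"
  shows "(\<lambda>x. laplace_quantile (f x) (g x)) \<in> borel_measurable M"
  unfolding laplace_quantile_def by measurable

lemma laplace_cdf_bounds: "b > 0 \<Longrightarrow> 0 \<le> laplace_cdf b x \<and> laplace_cdf b x \<le> 1"
proof -
  assume "b > 0"
  have "exp (y / b) \<le> 2" if "y \<le> 0" for y
  proof -
    have "exp (y / b) \<le> 1" using that \<open>b > 0\<close> by (simp add: divide_le_0_iff)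
    then show ?thesis by linarith
  qed
  from this[of x] this[of "- x"] show ?thesis by (simp add: laplace_cdf_def)
qed

text \<open>Up to a null set the preimage of \<open>{..x}\<close> is the interval from 0 to
  \<open>laplace_cdf b x\<close>, so the two distribution functions agree.\<close>

lemma distr_uniform_laplace_quantile:
  assumes "b > 0"
  shows "distr uniform borel (laplace_quantile b) = laplace b"
proof (rule cdf_unique)
  interpret U: prob_space uniform by (rule prob_space_uniform)
  show "real_distribution (distr uniform borel (laplace_quantile b))"
    by (rule U.real_distribution_distr) measurable
  show "real_distribution (laplace b)"
    using prob_space_laplace[OF assms] by (simp add: real_distribution_def real_distribution_axioms_def)
  show "cdf (distr uniform borel (laplace_quantile b)) = cdf (laplace b)"
  proof
    fix x
    have bd: "0 \<le> laplace_cdf b x" "laplace_cdf b x \<le> 1" using laplace_cdf_bounds[OF assms] by auto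
    have "emeasure uniform (laplace_quantile b -` {..x}) = emeasure uniform {0<..laplace_cdf b x}"
    proof (rule emeasure_eq_AE)
      show "AE u in uniform. u \<in> laplace_quantile b -` {..x} \<longleftrightarrow> u \<in> {0<..laplace_cdf b x}"
        using AE_uniform by eventually_elim (use laplace_quantile_le_iff[OF assms] in auto)
      show "laplace_quantile b -` {..x} \<in> sets uniform"
        using measurable_sets[of "laplace_quantile b" borel borel "{..x}"] by simp
    qed simp
    also have "\<dots> = ennreal (laplace_cdf b x)" using measure_uniform_Ioc[of 0 "laplace_cdf b x"] bd by simp
    finally show "cdf (distr uniform borel (laplace_quantile b)) x = cdf (laplace b) x"
      using bd by (simp add: cdf_def measure_distr measure_def[of uniform] measure_laplace_atMost[OF assms])
  qed
qed

text \<open>The half-open intervals between consecutive partial sums partition the range from 0 to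
  the total weight. At the first index the lower bound comes from \<open>u > 0\<close>, at the last
  one the upper bound comes from \<open>u \<le> 1\<close>.\<close>

lemma pick_eq_iff:
  assumes w: "\<And>i. w i > 0" and u: "0 < u" "u \<le> 1" and m: "1 \<le> m"
  shows "pick m w u = l \<longleftrightarrow>
    l \<in> {1..m} \<and> sum w {1..<l} < u * sum w {1..m} \<and> u * sum w {1..m} \<le> sum w {1..l}"
proof -
  let ?P = "\<lambda>l. 1 \<le> l \<and> (l = m \<or> \<not> sum w {1..l} < u * sum w {1..m})"
  let ?Q = "\<lambda>l. l \<in> {1..m} \<and> sum w {1..<l} < u * sum w {1..m} \<and> u * sum w {1..m} \<le> sum w {1..l}"
  have W: "sum w {1..m} > 0" using m w by (intro sum_pos) auto
  have mono: "sum w {1..k} \<le> sum w {1..<l}" if "k < l" for k l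
    using that by (intro sum_mono2) (auto intro: less_imp_le w)
  have Q_imp: "pick m w u = l" if "?Q l" for l
    unfolding pick_def
  proof (rule Least_equality)
    fix k assume k: "?P k"
    show "l \<le> k"
    proof (rule ccontr)
      assume "\<not> l \<le> k"
      with mono[of k l] that k show False by auto
    qed
  qed (use that in auto)
  have Q_pick: "?Q (pick m w u)"
  proof -
    define l where "l = pick m w u"
    have P: "?P l" unfolding l_def pick_def by (rule LeastI[of ?P m]) (use m in simp)
    have "l \<le> m" unfolding l_def pick_def by (rule Least_le) (use m in simp)
    have "sum w {1..<l} < u * sum w {1..m}"
    proof (cases "l = 1")
      case False
      then have "\<not> ?P (l - 1)" using P not_less_Least[of "l - 1" ?P] unfolding l_def pick_def by simp
      moreover have "1 \<le> l - 1" using P False by linarith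
      ultimately have "sum w {1..l - 1} < u * sum w {1..m}" by blast
      moreover have "{1..l - 1} = {1..<l}" using P by auto
      ultimately show ?thesis by simp
    next
      case True
      then show ?thesis using mult_pos_pos[OF u(1) W] by simp
    qed
    moreover have "u * sum w {1..m} \<le> sum w {1..l}"
    proof (cases "l = m")
      case True
      then show ?thesis using mult_right_mono[OF u(2), of "sum w {1..m}"] W by simp
    next
      case False
      then show ?thesis using P unfolding not_less by blast
    qed
    ultimately have "?Q l" using P \<open>l \<le> m\<close> by simp
    then show ?thesis by (simp only: l_def)
  qed
  show ?thesis
  proof
    assume "pick m w u = l"
    with Q_pick show "?Q l" by (simp only:)
  qed (rule Q_imp)
qed

lemma measurable_pick [measurable]: "pick m w \<in> borel \<rightarrow>\<^sub>M count_space UNIV"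
proof -
  have "Measurable.pred borel (\<lambda>u. 1 \<le> l \<and> (l = m \<or> \<not> a < u * b))" for l and a b :: real
    by measurable
  then show ?thesis unfolding pick_def by (intro measurable_Least)
qed

lemma emeasure_uniform_pick:
  assumes w: "\<And>i. w i > 0" and l: "l \<in> {1..m}"
  shows "emeasure uniform (pick m w -` {l}) = ennreal (w l / sum w {1..m})"
proof -
  let ?W = "sum w {1..m}"
  have W: "?W > 0" using l w by (intro sum_pos) auto
  have "emeasure uniform (pick m w -` {l}) =
      emeasure uniform {sum w {1..<l} / ?W<..sum w {1..l} / ?W}"
  proof (rule emeasure_eq_AE)
    show "AE u in uniform. u \<in> pick m w -` {l} \<longleftrightarrow> u \<in> {sum w {1..<l} / ?W<..sum w {1..l} / ?W}"
      using AE_uniform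
    proof eventually_elim
      case (elim u)
      have "pick m w u = l \<longleftrightarrow> sum w {1..<l} < u * ?W \<and> u * ?W \<le> sum w {1..l}"
        using pick_eq_iff[of w u m l] w l elim by simp
      then show ?case using W by (simp add: pos_divide_less_eq pos_le_divide_eq)
    qed
    show "pick m w -` {l} \<in> sets uniform"
      using measurable_sets[of "pick m w" borel "count_space UNIV" "{l}"] by simp
  qed simp
  also have "\<dots> = ennreal (sum w {1..l} / ?W - sum w {1..<l} / ?W)"
  proof (rule measure_uniform_Ioc)
    show "sum w {1..<l} / ?W \<le> sum w {1..l} / ?W"
      using W by (intro divide_right_mono sum_mono2) (auto intro: less_imp_le w)
    have "sum w {1..l} \<le> ?W" using l by (intro sum_mono2) (auto intro: less_imp_le w)
    then show "sum w {1..l} / ?W \<le> 1" using W by simp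
    show "0 \<le> sum w {1..<l} / ?W" using W by (intro divide_nonneg_pos sum_nonneg) (auto intro: less_imp_le w)
  qed
  also have "sum w {1..l} / ?W - sum w {1..<l} / ?W = w l / ?W"
  proof -
    have "{1..l} = insert l {1..<l}" using l by auto
    then show ?thesis by (simp add: add_divide_distrib)
  qed
  finally show ?thesis .
qed

text \<open>Verifies that the quotients sum to one, which is what lets \<open>embed_pmf\<close>
  return them as probabilities.\<close>

lemma pmf_gem:
  assumes "1 \<le> m"
  shows "pmf (gem D m q \<Delta> \<epsilon> \<beta>) i = (if i \<in> {1..m}
    then exp (\<epsilon> * gem_score D m q \<Delta> \<epsilon> \<beta> i / 2) /
         (\<Sum>k\<in>{1..m}. exp (\<epsilon> * gem_score D m q \<Delta> \<epsilon> \<beta> k / 2)) else 0)"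
proof -
  define w where "w i = exp (\<epsilon> * gem_score D m q \<Delta> \<epsilon> \<beta> i / 2)" for i
  have W: "sum w {1..m} > 0" using assms by (intro sum_pos) (auto simp: w_def)
  have "(\<integral>\<^sup>+i. ennreal (if i \<in> {1..m} then w i / sum w {1..m} else 0) \<partial>count_space UNIV)
      = (\<Sum>i\<in>{1..m}. ennreal (w i / sum w {1..m}))"
    by (subst nn_integral_count_space'[of "{1..m}"]) auto
  also have "\<dots> = ennreal (\<Sum>i\<in>{1..m}. w i / sum w {1..m})"
    using W by (intro sum_ennreal) (auto simp: w_def)
  also have "(\<Sum>i\<in>{1..m}. w i / sum w {1..m}) = 1"
    using W by (simp flip: sum_divide_distrib)
  finally have "pmf (embed_pmf (\<lambda>i. if i \<in> {1..m} then w i / sum w {1..m} else 0)) i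
      = (if i \<in> {1..m} then w i / sum w {1..m} else 0)"
    using W by (intro pmf_embed_pmf) (auto simp: w_def)
  then show ?thesis unfolding gem_def w_def .
qed

section \<open>Privacy\<close>

text \<open>The law of the output once level \<open>l\<close> has been selected.\<close>

definition noisy_count ::
    "real \<Rightarrow> real \<Rightarrow> 'a::linorder set list \<Rightarrow> nat \<Rightarrow> (nat \<times> real) measure" where
  "noisy_count \<epsilon> \<beta> D l =
     distr (laplace (2 * real l / \<epsilon>)) output_space (\<lambda>x. (l, count_query \<epsilon> \<beta> l D + x))"

lemma sets_slice: "S \<in> sets output_space \<Longrightarrow> Pair l -` S \<in> sets (borel :: real measure)" for l :: nat
  by (rule sets_Pair1)

lemma emeasure_noisy_count:
  assumes "S \<in> sets output_space"
  shows "emeasure (noisy_count \<epsilon> \<beta> D l) S =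
    emeasure (laplace (2 * real l / \<epsilon>)) ((+) (count_query \<epsilon> \<beta> l D) -` (Pair l -` S))"
  unfolding noisy_count_def
  by (subst emeasure_distr) (use assms in \<open>auto simp: vimage_def\<close>)

lemma sets_noisy_count [simp]: "sets (noisy_count \<epsilon> \<beta> D l) = sets output_space"
  by (simp add: noisy_count_def)

lemma space_noisy_count [simp]: "space (noisy_count \<epsilon> \<beta> D l) = UNIV"
  by (simp add: noisy_count_def space_pair_measure)

lemma UNIV_output_space: "UNIV \<in> sets output_space"
  using sets.top[of output_space] by (simp add: space_pair_measure)

lemma prob_space_noisy_count:
  assumes "\<epsilon> > 0" "1 \<le> l"
  shows "prob_space (noisy_count \<epsilon> \<beta> D l)"
proof -
  interpret prob_space "laplace (2 * real l / \<epsilon>)"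
    using assms by (intro prob_space_laplace) auto
  show ?thesis unfolding noisy_count_def by (rule prob_space_distr) measurable
qed

text \<open>The bind ranges over all natural numbers, so its kernel has to be a subprobability at
  level 0 too.\<close>

lemma noisy_count_subprob:
  assumes "\<epsilon> > 0"
  shows "noisy_count \<epsilon> \<beta> D l \<in> space (subprob_algebra output_space)"
proof -
  have "subprob_space (noisy_count \<epsilon> \<beta> D l)"
  proof (cases "l = 0")
    \<comment> \<open>The scale is 0, division by zero makes the density vanish, and the result is
      the null measure.\<close>
    case True
    show ?thesis
    proof
      show "emeasure (noisy_count \<epsilon> \<beta> D l) (space (noisy_count \<epsilon> \<beta> D l)) \<le> 1"
        using True emeasure_noisy_count[OF UNIV_output_space, of \<epsilon> \<beta> D l]
        by (simp add: space_noisy_count emeasure_laplace)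
    qed (simp add: noisy_count_def space_pair_measure)
  next
    case False
    then show ?thesis
      using prob_space_noisy_count[OF assms, of l] by (intro prob_space_imp_subprob_space) auto
  qed
  then show ?thesis by (simp add: space_subprob_algebra noisy_count_def)
qed

abbreviation level_pmf :: "nat \<Rightarrow> real \<Rightarrow> real \<Rightarrow> 'a::linorder set list \<Rightarrow> nat pmf" where
  "level_pmf m \<epsilon> \<beta> D \<equiv> gem D m (count_query \<epsilon> \<beta>) real (\<epsilon> / 2) \<beta>"

lemma dp_approx_distinct_count_eq_bind:
  "dp_approx_distinct_count m \<epsilon> \<beta> D = measure_pmf (level_pmf m \<epsilon> \<beta> D) \<bind> noisy_count \<epsilon> \<beta> D"
  unfolding dp_approx_distinct_count_def noisy_count_def ..

lemma measurable_noisy_count: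
  "\<epsilon> > 0 \<Longrightarrow> noisy_count \<epsilon> \<beta> D \<in> measure_pmf p \<rightarrow>\<^sub>M subprob_algebra output_space"
  by (auto simp: noisy_count_subprob)

lemma sets_dp [simp]:
  "\<epsilon> > 0 \<Longrightarrow> sets (dp_approx_distinct_count m \<epsilon> \<beta> D) = sets output_space"
  unfolding dp_approx_distinct_count_eq_bind
  by (rule sets_bind) simp_all

lemma space_dp [simp]:
  "\<epsilon> > 0 \<Longrightarrow> space (dp_approx_distinct_count m \<epsilon> \<beta> D) = UNIV"
  using sets_eq_imp_space_eq[OF sets_dp] by (simp add: space_pair_measure)

lemma emeasure_dp:
  assumes "\<epsilon> > 0" "S \<in> sets output_space"
  shows "emeasure (dp_approx_distinct_count m \<epsilon> \<beta> D) S =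
    (\<integral>\<^sup>+l. emeasure (noisy_count \<epsilon> \<beta> D l) S \<partial>measure_pmf (level_pmf m \<epsilon> \<beta> D))"
  unfolding dp_approx_distinct_count_eq_bind
  by (rule emeasure_bind[OF _ measurable_noisy_count]) (use assms in auto)

text \<open>GEM puts no mass outside \<open>{1..m}\<close>, so the output law is a finite mixture.
  Privacy and utility are then argued term by term.\<close>

lemma measure_dp:
  assumes "\<epsilon> > 0" "1 \<le> m" "S \<in> sets output_space"
  shows "measure (dp_approx_distinct_count m \<epsilon> \<beta> D) S =
    (\<Sum>l\<in>{1..m}. pmf (level_pmf m \<epsilon> \<beta> D) l * measure (noisy_count \<epsilon> \<beta> D l) S)"
proof -
  let ?p = "level_pmf m \<epsilon> \<beta> D"
  have "emeasure (dp_approx_distinct_count m \<epsilon> \<beta> D) S =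
      (\<Sum>l\<in>{1..m}. ennreal (pmf ?p l) * emeasure (noisy_count \<epsilon> \<beta> D l) S)"
    unfolding emeasure_dp[OF assms(1,3)] nn_integral_measure_pmf
    by (rule nn_integral_count_space') (use assms(2) in \<open>auto simp: pmf_gem\<close>)
  also have "\<dots> = (\<Sum>l\<in>{1..m}. ennreal (pmf ?p l * measure (noisy_count \<epsilon> \<beta> D l) S))"
  proof (rule sum.cong[OF refl])
    fix l assume "l \<in> {1..m}"
    then interpret prob_space "noisy_count \<epsilon> \<beta> D l"
      using assms by (intro prob_space_noisy_count) auto
    show "ennreal (pmf ?p l) * emeasure (noisy_count \<epsilon> \<beta> D l) S =
        ennreal (pmf ?p l * measure (noisy_count \<epsilon> \<beta> D l) S)"
      by (simp add: emeasure_eq_measure ennreal_mult)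
  qed
  also have "\<dots> = ennreal (\<Sum>l\<in>{1..m}. pmf ?p l * measure (noisy_count \<epsilon> \<beta> D l) S)"
    by (rule sum_ennreal) simp
  finally show ?thesis by (simp add: measure_def sum_nonneg)
qed

lemma sum_pmf_gem:
  assumes "1 \<le> m"
  shows "(\<Sum>l\<in>{1..m}. pmf (gem D m q \<Delta> \<epsilon> \<beta>) l) = 1"
proof (rule sum_pmf_eq_1)
  show "set_pmf (gem D m q \<Delta> \<epsilon> \<beta>) \<subseteq> {1..m}"
    using assms by (auto simp: set_pmf_eq pmf_gem)
qed simp

lemma prob_space_dp:
  assumes "\<epsilon> > 0" "1 \<le> m"
  shows "prob_space (dp_approx_distinct_count m \<epsilon> \<beta> D)"
proof -
  have "measure (noisy_count \<epsilon> \<beta> D l) UNIV = 1" if "l \<in> {1..m}" for l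
  proof -
    interpret prob_space "noisy_count \<epsilon> \<beta> D l"
      using assms that by (intro prob_space_noisy_count) auto
    show ?thesis using prob_space by (simp add: noisy_count_def space_pair_measure)
  qed
  then have "measure (dp_approx_distinct_count m \<epsilon> \<beta> D) UNIV = 1"
    using sum_pmf_gem[OF assms(2)] by (simp add: measure_dp[OF assms UNIV_output_space])
  then show ?thesis
    using assms by (intro prob_spaceI) (simp add: measure_def)
qed

text \<open>It suffices to compare the quotients at a \<open>j\<close> that is minimal for
  \<open>D'\<close>. The numerator changes by at most \<open>\<Delta> i + \<Delta> j\<close>, which
  is the denominator.\<close>

lemma gem_score_sensitivity:
  assumes "1 \<le> m" "i \<in> {1..m}"
    and "\<And>j. j \<in> {1..m} \<Longrightarrow> \<Delta> j > 0" "\<And>j. j \<in> {1..m} \<Longrightarrow> \<bar>q j D - q j D'\<bar> \<le> \<Delta> j"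
  shows "gem_score D m q \<Delta> \<epsilon> \<beta> i \<le> gem_score D' m q \<Delta> \<epsilon> \<beta> i + 1"
proof -
  define t where "t = 2 / \<epsilon> * ln (real m / \<beta>)"
  define f where "f D j = ((q i D - t * \<Delta> i) - (q j D - t * \<Delta> j)) / (\<Delta> i + \<Delta> j)" for D j
  have s: "gem_score D m q \<Delta> \<epsilon> \<beta> i = Min (f D ` {1..m})" for D
    by (simp add: gem_score_def f_def t_def)
  have "Min (f D' ` {1..m}) \<in> f D' ` {1..m}" using assms(1) by (intro Min_in) auto
  then obtain j where j: "j \<in> {1..m}" "Min (f D' ` {1..m}) = f D' j" by auto
  have pos: "\<Delta> i + \<Delta> j > 0" using assms(2,3) j(1) by (simp add: add_pos_pos)
  have "f D j - f D' j = ((q i D - q i D') - (q j D - q j D')) / (\<Delta> i + \<Delta> j)"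
    unfolding f_def diff_divide_distrib[symmetric] by (simp add: algebra_simps)
  also have "\<dots> \<le> 1" using pos assms(4)[OF assms(2)] assms(4)[OF j(1)] by (simp add: abs_le_iff)
  finally have "f D j \<le> f D' j + 1" by simp
  moreover have "Min (f D ` {1..m}) \<le> f D j" using j by simp
  ultimately show ?thesis unfolding s j(2) by simp
qed

text \<open>A change of the scores by at most 1 costs a factor \<open>exp (\<epsilon> / 2)\<close>
  in the weight of \<open>i\<close> and another one in the normaliser.\<close>

lemma gem_private:
  assumes "1 \<le> m" "\<epsilon> > 0"
    and "\<And>j. j \<in> {1..m} \<Longrightarrow> \<Delta> j > 0" "\<And>j. j \<in> {1..m} \<Longrightarrow> \<bar>q j D - q j D'\<bar> \<le> \<Delta> j"
  shows "pmf (gem D m q \<Delta> \<epsilon> \<beta>) i \<le> exp \<epsilon> * pmf (gem D' m q \<Delta> \<epsilon> \<beta>) i"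
proof (cases "i \<in> {1..m}")
  case True
  define w where "w D i = exp (\<epsilon> * gem_score D m q \<Delta> \<epsilon> \<beta> i / 2)" for D i
  have pos: "w D i > 0" "sum (w D) {1..m} > 0" for D i
    using assms(1) by (auto simp: w_def intro!: sum_pos)
  have le: "w X i \<le> exp (\<epsilon> / 2) * w Y i"
    if "i \<in> {1..m}" and "\<And>j. j \<in> {1..m} \<Longrightarrow> \<bar>q j X - q j Y\<bar> \<le> \<Delta> j" for X Y i
  proof -
    have "gem_score X m q \<Delta> \<epsilon> \<beta> i \<le> gem_score Y m q \<Delta> \<epsilon> \<beta> i + 1"
      using assms(1) that(1) assms(3) that(2) by (rule gem_score_sensitivity)
    then have "\<epsilon> * gem_score X m q \<Delta> \<epsilon> \<beta> i / 2 \<le> \<epsilon> / 2 + \<epsilon> * gem_score Y m q \<Delta> \<epsilon> \<beta> i / 2"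
      using assms(2) mult_left_mono[of _ _ \<epsilon>] by (fastforce simp: distrib_left)
    then show ?thesis unfolding w_def by (simp flip: exp_add)
  qed
  have 1: "w D i \<le> exp (\<epsilon> / 2) * w D' i" using le[OF True] assms(4) by blast
  have 2: "sum (w D') {1..m} \<le> exp (\<epsilon> / 2) * sum (w D) {1..m}"
    unfolding sum_distrib_left
    by (intro sum_mono le) (use assms(4) in \<open>auto simp: abs_minus_commute\<close>)
  have "w D i * sum (w D') {1..m} \<le> (exp (\<epsilon> / 2) * w D' i) * (exp (\<epsilon> / 2) * sum (w D) {1..m})"
    using 1 2 pos by (intro mult_mono) (auto intro: less_imp_le)
  also have "\<dots> = exp \<epsilon> * (w D' i * sum (w D) {1..m})"
    by (simp add: algebra_simps flip: exp_add)
  finally have "w D i / sum (w D) {1..m} \<le> exp \<epsilon> * (w D' i / sum (w D') {1..m})"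
    using pos by (simp add: field_simps)
  then show ?thesis using True assms(1) by (simp add: pmf_gem w_def)
next
  case False
  then show ?thesis unfolding pmf_gem[OF assms(1)] if_not_P[OF False] by simp
qed

text \<open>By the triangle inequality the two translated densities differ pointwise by at most the
  stated factor; integrate over \<open>T\<close>.\<close>

lemma laplace_shift:
  assumes "b > 0" and T [measurable]: "T \<in> sets borel"
  shows "emeasure (laplace b) ((+) c -` T) \<le>
    ennreal (exp (\<bar>c - c'\<bar> / b)) * emeasure (laplace b) ((+) c' -` T)"
proof -
  let ?f = "\<lambda>x::real. 1 / (2 * b) * exp (- \<bar>x\<bar> / b)"
  have eq: "emeasure (laplace b) ((+) a -` T) = (\<integral>\<^sup>+y. ennreal (?f (y - a)) * indicator T y \<partial>lborel)" for a
  proof -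
    have "(+) a -` T \<in> sets borel"
      using measurable_sets[of "(+) a" borel borel T] T by simp
    then show ?thesis
      by (subst nn_integral_real_affine[where c = 1 and t = a])
         (auto simp: emeasure_laplace indicator_def intro!: nn_integral_cong)
  qed
  have "ennreal (?f (y - c)) \<le> ennreal (exp (\<bar>c - c'\<bar> / b)) * ennreal (?f (y - c'))" for y
  proof -
    have "\<bar>y - c'\<bar> - \<bar>y - c\<bar> \<le> \<bar>c - c'\<bar>" by linarith
    then have "(\<bar>y - c'\<bar> - \<bar>y - c\<bar>) / b \<le> \<bar>c - c'\<bar> / b"
      using assms(1) by (intro divide_right_mono) auto
    then have "- \<bar>y - c\<bar> / b \<le> \<bar>c - c'\<bar> / b + - \<bar>y - c'\<bar> / b"
      by (simp add: diff_divide_distrib)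
    then have "exp (- \<bar>y - c\<bar> / b) \<le> exp (\<bar>c - c'\<bar> / b) * exp (- \<bar>y - c'\<bar> / b)"
      unfolding exp_add[symmetric] exp_le_cancel_iff .
    then have "?f (y - c) \<le> exp (\<bar>c - c'\<bar> / b) * ?f (y - c')"
      using assms(1) by (simp add: divide_right_mono)
    then show ?thesis using assms(1) by (simp add: ennreal_leI flip: ennreal_mult)
  qed
  then have "emeasure (laplace b) ((+) c -` T) \<le>
      (\<integral>\<^sup>+y. ennreal (exp (\<bar>c - c'\<bar> / b)) * (ennreal (?f (y - c')) * indicator T y) \<partial>lborel)"
    unfolding eq by (intro nn_integral_mono) (auto simp: indicator_def)
  also have "\<dots> = ennreal (exp (\<bar>c - c'\<bar> / b)) * emeasure (laplace b) ((+) c' -` T)"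
    unfolding eq by (rule nn_integral_cmult) measurable
  finally show ?thesis .
qed

lemma count_query_sensitivity:
  assumes "D \<in> datasets" "D' \<in> datasets" "neighboring D D'"
  shows "\<bar>count_query \<epsilon> \<beta> l D - count_query \<epsilon> \<beta> l D'\<bar> \<le> real l"
  using card_greedy_sensitivity[OF assms] by (simp add: count_query_def)

text \<open>Sensitivity \<open>l\<close> against scale \<open>2 * l / \<epsilon>\<close> leaves a
  privacy loss of \<open>\<epsilon> / 2\<close>, the same at every level.\<close>

lemma noisy_count_private:
  assumes "\<epsilon> > 0" "1 \<le> l" "S \<in> sets output_space"
    and "D \<in> datasets" "D' \<in> datasets" "neighboring D D'"
  shows "measure (noisy_count \<epsilon> \<beta> D l) S \<le> exp (\<epsilon> / 2) * measure (noisy_count \<epsilon> \<beta> D' l) S"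
proof -
  let ?b = "2 * real l / \<epsilon>" and ?q = "count_query \<epsilon> \<beta> l"
  interpret D: prob_space "noisy_count \<epsilon> \<beta> D l" using assms by (intro prob_space_noisy_count)
  interpret D': prob_space "noisy_count \<epsilon> \<beta> D' l" using assms by (intro prob_space_noisy_count)
  have b: "?b > 0" using assms by simp
  have "\<bar>?q D - ?q D'\<bar> / ?b \<le> real l / ?b"
    using count_query_sensitivity[OF assms(4-6)] b by (intro divide_right_mono) auto
  also have "\<dots> = \<epsilon> / 2" using assms by simp
  finally have "exp (\<bar>?q D - ?q D'\<bar> / ?b) \<le> exp (\<epsilon> / 2)" by simp
  then have "emeasure (noisy_count \<epsilon> \<beta> D l) S \<le> ennreal (exp (\<epsilon> / 2)) * emeasure (noisy_count \<epsilon> \<beta> D' l) S"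
    unfolding emeasure_noisy_count[OF assms(3)]
    by (intro order_trans[OF laplace_shift[OF b sets_slice[OF assms(3)], where c' = "?q D'"]] mult_right_mono ennreal_leI) auto
  then show ?thesis
    by (simp add: D.emeasure_eq_measure D'.emeasure_eq_measure flip: ennreal_mult)
qed

text \<open>Composition: for each level, its selection and the noisy count given that level
  contribute one factor \<open>exp (\<epsilon> / 2)\<close> each.\<close>

lemma dp_approx_distinct_count_private:
  assumes "\<epsilon> > 0" "1 \<le> m"
  shows "differentially_private \<epsilon> output_space (dp_approx_distinct_count m \<epsilon> \<beta>)"
  unfolding differentially_private_def
proof (intro conjI ballI impI)
  fix D :: "'a set list"
  show "dp_approx_distinct_count m \<epsilon> \<beta> D \<in> space (prob_algebra output_space)"
    using assms prob_space_dp by (simp add: space_prob_algebra)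
next
  fix D D' :: "'a set list" and S
  assume *: "D \<in> datasets" "D' \<in> datasets" "neighboring D D'" "S \<in> sets output_space"
  have "pmf (level_pmf m \<epsilon> \<beta> D) l * measure (noisy_count \<epsilon> \<beta> D l) S \<le>
      exp \<epsilon> * (pmf (level_pmf m \<epsilon> \<beta> D') l * measure (noisy_count \<epsilon> \<beta> D' l) S)"
    if "l \<in> {1..m}" for l
  proof -
    have "pmf (level_pmf m \<epsilon> \<beta> D) l * measure (noisy_count \<epsilon> \<beta> D l) S \<le>
        (exp (\<epsilon> / 2) * pmf (level_pmf m \<epsilon> \<beta> D') l) *
        (exp (\<epsilon> / 2) * measure (noisy_count \<epsilon> \<beta> D' l) S)"
      using assms * that
      by (intro mult_mono gem_private noisy_count_private count_query_sensitivity) auto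
    also have "\<dots> = (exp (\<epsilon> / 2) * exp (\<epsilon> / 2)) *
        (pmf (level_pmf m \<epsilon> \<beta> D') l * measure (noisy_count \<epsilon> \<beta> D' l) S)"
      by (simp only: mult_ac)
    also have "exp (\<epsilon> / 2) * exp (\<epsilon> / 2) = exp \<epsilon>" by (simp flip: exp_add)
    finally show ?thesis .
  qed
  then show "measure (dp_approx_distinct_count m \<epsilon> \<beta> D) S \<le>
      exp \<epsilon> * measure (dp_approx_distinct_count m \<epsilon> \<beta> D') S"
    unfolding measure_dp[OF assms *(4)] sum_distrib_left by (intro sum_mono)
qed

section \<open>Utility\<close>

lemma sets_snd_le [measurable]: "{p. snd p \<le> c} \<in> sets output_space" for c :: real
proof -
  have "{p \<in> space output_space. snd p \<le> c} \<in> sets output_space" by measurable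
  then show ?thesis by (simp add: space_pair_measure)
qed

lemma sets_snd_ge [measurable]: "{p. snd p \<ge> c} \<in> sets output_space" for c :: real
proof -
  have "{p \<in> space output_space. snd p \<ge> c} \<in> sets output_space" by measurable
  then show ?thesis by (simp add: space_pair_measure)
qed

lemma measure_noisy_count_le:
  assumes "\<epsilon> > 0" "1 \<le> l"
  shows "measure (noisy_count \<epsilon> \<beta> D l) {p. snd p \<le> c} =
    laplace_cdf (2 * real l / \<epsilon>) (c - count_query \<epsilon> \<beta> l D)"
proof -
  have "(+) (count_query \<epsilon> \<beta> l D) -` (Pair l -` {p. snd p \<le> c}) = {..c - count_query \<epsilon> \<beta> l D}"
    by auto
  then show ?thesis
    using measure_laplace_atMost[of "2 * real l / \<epsilon>"] assms
    by (simp add: measure_def emeasure_noisy_count[OF sets_snd_le])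
qed

lemma measure_noisy_count_ge:
  assumes "\<epsilon> > 0" "1 \<le> l"
  shows "measure (noisy_count \<epsilon> \<beta> D l) {p. snd p \<ge> c} =
    laplace_cdf (2 * real l / \<epsilon>) (count_query \<epsilon> \<beta> l D - c)"
proof -
  have "(+) (count_query \<epsilon> \<beta> l D) -` (Pair l -` {p. snd p \<ge> c}) = {c - count_query \<epsilon> \<beta> l D..}"
    by auto
  then show ?thesis
    using measure_laplace_atLeast[of "2 * real l / \<epsilon>"] assms
    by (simp add: measure_def emeasure_noisy_count[OF sets_snd_ge])
qed

text \<open>At scale \<open>2 * l / \<epsilon>\<close> the threshold is exactly the amount that
  \<open>count_query\<close> subtracts. It is positive because \<open>\<beta> < 1 / 2\<close>, so
  the upper branch of the distribution function applies.\<close>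

lemma laplace_cdf_tail:
  assumes "b > 0" "0 < \<beta>" "\<beta> < 1 / 2" "b * ln (1 / (2 * \<beta>)) \<le> y"
  shows "1 - \<beta> \<le> laplace_cdf b y"
proof -
  have "0 < ln (1 / (2 * \<beta>))" using assms by simp
  then have "0 < b * ln (1 / (2 * \<beta>))" using assms(1) by simp
  then have y: "0 < y" using assms(4) by linarith
  have "ln (1 / (2 * \<beta>)) \<le> y / b" using assms(1,4) by (simp add: pos_le_divide_eq mult.commute)
  then have "- y / b \<le> ln (2 * \<beta>)" using assms(2) by (simp add: ln_div)
  then have "exp (- y / b) \<le> exp (ln (2 * \<beta>))" by (simp only: exp_le_cancel_iff)
  then have "exp (- y / b) \<le> 2 * \<beta>" using assms(2) by simp
  then show ?thesis using y by (simp add: laplace_cdf_def)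
qed

text \<open>At each level the output exceeds the greedy cardinality only if the noise exceeds the
  subtracted amount. The bound holds for every level and hence for the mixture, however the level is
  selected.\<close>

lemma dp_approx_distinct_count_lower:
  assumes "\<epsilon> > 0" "0 < \<beta>" "\<beta> < 1 / 2" "1 \<le> m" "D \<in> datasets"
  shows "1 - \<beta> \<le> measure (dp_approx_distinct_count m \<epsilon> \<beta> D) {p. snd p \<le> real (distinct_count D)}"
proof -
  let ?p = "pmf (level_pmf m \<epsilon> \<beta> D)" and ?S = "{p :: nat \<times> real. snd p \<le> real (distinct_count D)}"
  have le: "1 - \<beta> \<le> measure (noisy_count \<epsilon> \<beta> D l) ?S" if "l \<in> {1..m}" for l
  proof -
    have l: "1 \<le> l" using that by simp
    show ?thesis unfolding measure_noisy_count_le[OF assms(1) l]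
      by (rule laplace_cdf_tail)
         (use assms(1-3) card_greedy_le[OF assms(5), of l] l in \<open>simp_all add: count_query_def\<close>)
  qed
  have "1 - \<beta> = (\<Sum>l\<in>{1..m}. ?p l * (1 - \<beta>))"
    by (simp only: sum_distrib_right[symmetric] sum_pmf_gem[OF assms(4)] mult_1)
  also have "\<dots> \<le> (\<Sum>l\<in>{1..m}. ?p l * measure (noisy_count \<epsilon> \<beta> D l) ?S)"
    by (intro sum_mono mult_left_mono le) auto
  finally show ?thesis unfolding measure_dp[OF assms(1,4) sets_snd_le] .
qed

text \<open>For an \<open>i\<close> maximising \<open>q i D - t * \<Delta> i\<close> all numerators
  are nonnegative.\<close>

lemma exists_gem_score_nonneg:
  assumes "1 \<le> m" "\<And>j. j \<in> {1..m} \<Longrightarrow> \<Delta> j > 0"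
  shows "\<exists>i\<in>{1..m}. gem_score D m q \<Delta> \<epsilon> \<beta> i \<ge> 0"
proof -
  let ?a = "\<lambda>i. q i D - 2 / \<epsilon> * ln (real m / \<beta>) * \<Delta> i"
  have "Max (?a ` {1..m}) \<in> ?a ` {1..m}" using assms(1) by (intro Max_in) auto
  then obtain i where i: "i \<in> {1..m}" "?a i = Max (?a ` {1..m})" by auto
  have "0 \<le> (?a i - ?a j) / (\<Delta> i + \<Delta> j)" if "j \<in> {1..m}" for j
    using that i assms(2)[of i] assms(2)[of j] Max_ge[of "?a ` {1..m}" "?a j"]
    by (intro divide_nonneg_pos) auto
  with i(1) assms(1) show ?thesis
    by (intro bexI[of _ i]) (auto simp: gem_score_def Let_def)
qed

text \<open>Some score is nonnegative, so the normaliser is at least 1. A score below the threshold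
  gives a weight of at most \<open>\<beta> / m\<close>, and there are at most \<open>m\<close> such
  indices.\<close>

lemma gem_utility:
  assumes "1 \<le> m" "\<epsilon> > 0" "\<beta> > 0" "\<And>j. j \<in> {1..m} \<Longrightarrow> \<Delta> j > 0"
  shows "(\<Sum>i | i \<in> {1..m} \<and> gem_score D m q \<Delta> \<epsilon> \<beta> i < - (2 / \<epsilon> * ln (real m / \<beta>)).
    pmf (gem D m q \<Delta> \<epsilon> \<beta>) i) \<le> \<beta>"
proof -
  let ?s = "gem_score D m q \<Delta> \<epsilon> \<beta>" and ?t = "2 / \<epsilon> * ln (real m / \<beta>)"
  let ?B = "{i. i \<in> {1..m} \<and> ?s i < - ?t}"
  define w where "w i = exp (\<epsilon> * ?s i / 2)" for i
  obtain i where i: "i \<in> {1..m}" "?s i \<ge> 0"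
    using exists_gem_score_nonneg[of m \<Delta> D q \<epsilon> \<beta>] assms(1,4) by blast
  have "1 \<le> w i" using i(2) assms(2) by (simp add: w_def)
  also have "w i \<le> sum w {1..m}" using i(1) by (intro member_le_sum) (auto simp: w_def)
  finally have W: "1 \<le> sum w {1..m}" .
  have "pmf (gem D m q \<Delta> \<epsilon> \<beta>) k \<le> \<beta> / real m" if k: "k \<in> ?B" for k
  proof -
    have "\<epsilon> * ?s k \<le> \<epsilon> * - ?t" using k assms(2) by (intro mult_left_mono) auto
    then have "\<epsilon> * ?s k / 2 \<le> - ln (real m / \<beta>)" using assms(2) by simp
    then have "w k \<le> exp (- ln (real m / \<beta>))" unfolding w_def exp_le_cancel_iff .
    also have "\<dots> = \<beta> / real m" using assms by (simp add: exp_minus)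
    finally have wk: "w k \<le> \<beta> / real m" .
    have "pmf (gem D m q \<Delta> \<epsilon> \<beta>) k = w k / sum w {1..m}"
      using k by (simp add: pmf_gem[OF assms(1)] w_def)
    also have "\<dots> \<le> w k / 1" using W by (intro divide_left_mono) (auto simp: w_def)
    finally show ?thesis using wk by simp
  qed
  then have "(\<Sum>k\<in>?B. pmf (gem D m q \<Delta> \<epsilon> \<beta>) k) \<le> real (card ?B) * (\<beta> / real m)"
    by (rule sum_bounded_above)
  also have "card ?B \<le> m" using card_mono[of "{1..m}" ?B] by fastforce
  then have "real (card ?B) * (\<beta> / real m) \<le> real m * (\<beta> / real m)"
    using assms(3) by (intro mult_right_mono) auto
  finally show ?thesis using assms(1) by simp
qed

text \<open>After clearing the denominator of the quotient at \<open>j\<close>, the terms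
  \<open>t * \<Delta> i\<close> cancel. The loss therefore depends on the competitor
  \<open>j\<close> and not on the selected \<open>i\<close>.\<close>

lemma gem_score_imp_query_ge:
  assumes "- (2 / \<epsilon> * ln (real m / \<beta>)) \<le> gem_score D m q \<Delta> \<epsilon> \<beta> i"
    and "j \<in> {1..m}" "\<Delta> i > 0" "\<Delta> j > 0"
  shows "q j D - 2 * (2 / \<epsilon> * ln (real m / \<beta>)) * \<Delta> j \<le> q i D"
proof -
  define t where "t = 2 / \<epsilon> * ln (real m / \<beta>)"
  have "gem_score D m q \<Delta> \<epsilon> \<beta> i \<le> ((q i D - t * \<Delta> i) - (q j D - t * \<Delta> j)) / (\<Delta> i + \<Delta> j)"
    unfolding gem_score_def Let_def t_def[symmetric] using assms(2) by (intro Min_le) auto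
  with assms(1) have "- t \<le> ((q i D - t * \<Delta> i) - (q j D - t * \<Delta> j)) / (\<Delta> i + \<Delta> j)"
    by (simp only: t_def[symmetric])
  then have "- t * (\<Delta> i + \<Delta> j) \<le> (q i D - t * \<Delta> i) - (q j D - t * \<Delta> j)"
    using assms(3,4) by (subst (asm) pos_le_divide_eq) auto
  then show ?thesis unfolding t_def[symmetric] by (simp add: algebra_simps)
qed

lemma dp_approx_distinct_count_upper:
  assumes "\<epsilon> > 0" "0 < \<beta>" "\<beta> < 1 / 2" "D \<in> datasets"
    and ls: "\<And>u. u \<in> set D \<Longrightarrow> card u \<le> ls" "1 \<le> ls" "ls \<le> m"
  shows "1 - 2 * \<beta> \<le> measure (dp_approx_distinct_count m \<epsilon> \<beta> D)
    {p. snd p \<ge> 1 / 2 * real (distinct_count D) - 28 * real ls / \<epsilon> * ln (real m / \<beta>)}"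
proof -
  define L where "L = ln (real m / \<beta>)"
  define c where "c = 1 / 2 * real (distinct_count D) - 28 * real ls / \<epsilon> * L"
  let ?p = "pmf (level_pmf m \<epsilon> \<beta> D)" and ?S = "{p :: nat \<times> real. snd p \<ge> c}"
  let ?s = "gem_score D m (count_query \<epsilon> \<beta>) real (\<epsilon> / 2) \<beta>" and ?t = "2 / (\<epsilon> / 2) * ln (real m / \<beta>)"
  let ?B = "{l. l \<in> {1..m} \<and> ?s l < - ?t}" and ?G = "{l. l \<in> {1..m} \<and> \<not> ?s l < - ?t}"
  have m: "1 \<le> m" using ls by simp
  have lnb: "0 < ln (1 / (2 * \<beta>))" using assms by simp
  have Lb: "ln (1 / (2 * \<beta>)) \<le> L"
    unfolding L_def using assms m by (intro ln_mono) (auto simp: field_simps)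
  have good: "1 - \<beta> \<le> measure (noisy_count \<epsilon> \<beta> D l) ?S" if l: "l \<in> ?G" for l
  proof -
    let ?q = "\<lambda>l. count_query \<epsilon> \<beta> l D" and ?DC = "real (distinct_count D)"
    have l1: "1 \<le> l" using l by simp
    define E where "E = real ls / \<epsilon> * L"
    have "0 \<le> L" using lnb Lb by linarith
    then have "0 \<le> E" using assms(1) by (simp add: E_def)
    have "?q ls - 2 * ?t * real ls \<le> ?q l"
      by (rule gem_score_imp_query_ge) (use l ls in auto)
    \<comment> \<open>GEM runs with parameter \<open>\<epsilon> / 2\<close>, so \<open>t\<close> is
      \<open>4 / \<epsilon> * L\<close>.\<close>
    moreover have "2 * ?t * real ls = 8 * E" by (simp add: E_def L_def)
    moreover have "?q ls = ?DC - 2 * (real ls / \<epsilon> * ln (1 / (2 * \<beta>)))"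
      using greedy_exhaust[OF assms(4) ls(1)] by (simp add: count_query_def distinct_count_def)
    moreover have "real ls / \<epsilon> * ln (1 / (2 * \<beta>)) \<le> E"
      unfolding E_def using Lb assms by (intro mult_left_mono) auto
    ultimately have ql: "?DC - 10 * E \<le> ?q l" by linarith
    \<comment> \<open>The noise bound at level \<open>l\<close> is what the query falls short of the
      greedy cardinality; a query value close to the distinct count forces it to be small, however
      large \<open>l\<close> is.\<close>
    have "2 * real l / \<epsilon> * ln (1 / (2 * \<beta>)) = real (card (greedy D l)) - ?q l"
      by (simp add: count_query_def)
    also have "\<dots> \<le> ?DC - ?q l" using card_greedy_le[OF assms(4), of l] by simp
    \<comment> \<open>Required is \<open>2 * q l \<ge> DC + c\<close>, whose right side is
      \<open>3 / 2 * DC - 28 * E\<close>; the bound on \<open>q l\<close> gives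
      \<open>2 * DC - 20 * E\<close>.\<close>
    also have "\<dots> \<le> ?q l - c"
    proof -
      have "c = ?DC / 2 - 28 * E" by (simp add: c_def E_def)
      moreover have "0 \<le> ?DC" by simp
      ultimately show ?thesis using ql \<open>0 \<le> E\<close> by linarith
    qed
    finally have tail: "2 * real l / \<epsilon> * ln (1 / (2 * \<beta>)) \<le> ?q l - c" .
    show ?thesis unfolding measure_noisy_count_ge[OF assms(1) l1]
      by (rule laplace_cdf_tail[OF _ assms(2,3) tail]) (use assms(1) l1 in auto)
  qed
  have "sum ?p (?B \<union> ?G) = sum ?p ?B + sum ?p ?G"
    by (rule sum.union_disjoint) auto
  moreover have "?B \<union> ?G = {1..m}" by auto
  moreover have "sum ?p ?B \<le> \<beta>"
    by (rule gem_utility[OF m]) (use assms in auto)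
  moreover have "sum ?p {1..m} = 1" by (rule sum_pmf_gem[OF m])
  ultimately have pG: "1 - \<beta> \<le> sum ?p ?G" by simp
  \<comment> \<open>One factor stands for a good selection by GEM, the other for small noise at the
    selected level.\<close>
  have "1 - 2 * \<beta> \<le> (1 - \<beta>) * (1 - \<beta>)" by (simp add: algebra_simps)
  also have "\<dots> \<le> sum ?p ?G * (1 - \<beta>)" using pG assms(3) by (intro mult_right_mono) auto
  also have "\<dots> \<le> (\<Sum>l\<in>?G. ?p l * measure (noisy_count \<epsilon> \<beta> D l) ?S)"
    unfolding sum_distrib_right by (intro sum_mono mult_left_mono good) auto
  also have "\<dots> \<le> (\<Sum>l\<in>{1..m}. ?p l * measure (noisy_count \<epsilon> \<beta> D l) ?S)"
    by (intro sum_mono2) auto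
  finally show ?thesis
    unfolding c_def[symmetric] L_def[symmetric] measure_dp[OF assms(1) m sets_snd_ge] .
qed

section \<open>Implementation\<close>

text \<open>This holds for every real \<open>u\<close>, so the Laplace scale at the picked level is
  always positive.\<close>

lemma pick_range:
  assumes "1 \<le> m"
  shows "pick m w u \<in> {1..m}"
proof -
  let ?P = "\<lambda>l. 1 \<le> l \<and> (l = m \<or> \<not> sum w {1..l} < u * sum w {1..m})"
  have "?P (pick m w u)" unfolding pick_def by (rule LeastI[of ?P m]) (use assms in simp)
  moreover have "pick m w u \<le> m" unfolding pick_def by (rule Least_le) (use assms in simp)
  ultimately show ?thesis by simp
qed

lemma distr_uniform_pick:
  assumes "1 \<le> m"
  shows "distr uniform (count_space UNIV) (pick m (gem_weight D m \<epsilon> \<beta>)) =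
    measure_pmf (level_pmf m \<epsilon> \<beta> D)"
proof (rule measure_eqI_countable_AE)
  let ?w = "gem_weight D m \<epsilon> \<beta>"
  have meas: "pick m ?w \<in> uniform \<rightarrow>\<^sub>M count_space UNIV"
    using measurable_pick[of m ?w] by (simp cong: measurable_cong_sets)
  show "AE l in distr uniform (count_space UNIV) (pick m ?w). l \<in> {1..m}"
    by (subst AE_distr_iff[OF meas]) (use pick_range[OF assms, of ?w] in auto)
  show "AE l in measure_pmf (level_pmf m \<epsilon> \<beta> D). l \<in> {1..m}"
    unfolding AE_measure_pmf_iff by (auto simp: set_pmf_eq pmf_gem[OF assms] split: if_splits)
  fix l assume l: "l \<in> {1..m}"
  have "emeasure (distr uniform (count_space UNIV) (pick m ?w)) {l} = ennreal (?w l / sum ?w {1..m})"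
    using emeasure_uniform_pick[OF _ l, of ?w] by (simp add: emeasure_distr[OF meas] gem_weight_def)
  also have "\<dots> = emeasure (measure_pmf (level_pmf m \<epsilon> \<beta> D)) {l}"
    using l by (simp add: emeasure_pmf_single pmf_gem[OF assms] gem_weight_def)
  finally show "emeasure (distr uniform (count_space UNIV) (pick m ?w)) {l} =
      emeasure (measure_pmf (level_pmf m \<epsilon> \<beta> D)) {l}" .
qed simp_all

definition sampler ::
    "nat \<Rightarrow> real \<Rightarrow> real \<Rightarrow> 'a::linorder set list \<Rightarrow> real \<Rightarrow> real \<Rightarrow> nat \<times> real" where
  "sampler m \<epsilon> \<beta> D u v = (let l = pick m (gem_weight D m \<epsilon> \<beta>) u
     in (l, count_query \<epsilon> \<beta> l D + laplace_quantile (2 * real l / \<epsilon>) v))"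

lemma measurable_sampler [measurable]:
  assumes [measurable]: "f \<in> borel_measurable M" "g \<in> borel_measurable M"
  shows "(\<lambda>x. sampler m \<epsilon> \<beta> D (f x) (g x)) \<in> M \<rightarrow>\<^sub>M output_space"
  unfolding sampler_def Let_def by measurable

lemma nn_integral_sampler:
  assumes "\<epsilon> > 0" "1 \<le> m" and S [measurable]: "S \<in> sets output_space"
  shows "(\<integral>\<^sup>+v. indicator S (sampler m \<epsilon> \<beta> D u v) \<partial>uniform) =
    emeasure (noisy_count \<epsilon> \<beta> D (pick m (gem_weight D m \<epsilon> \<beta>) u)) S"
proof -
  let ?l = "pick m (gem_weight D m \<epsilon> \<beta>) u"
  let ?q = "count_query \<epsilon> \<beta> ?l D" and ?b = "2 * real ?l / \<epsilon>"
  let ?T = "(+) ?q -` (Pair ?l -` S)"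
  have b: "?b > 0" using pick_range[OF assms(2), of "gem_weight D m \<epsilon> \<beta>" u] assms(1) by simp
  have T: "?T \<in> sets borel"
    using measurable_sets[of "(+) ?q" borel borel, OF _ sets_slice[OF S]] by simp
  have meas: "laplace_quantile ?b \<in> uniform \<rightarrow>\<^sub>M borel" by measurable
  have "emeasure (noisy_count \<epsilon> \<beta> D ?l) S = emeasure (distr uniform borel (laplace_quantile ?b)) ?T"
    by (simp only: emeasure_noisy_count[OF S] distr_uniform_laplace_quantile[OF b])
  also have "\<dots> = (\<integral>\<^sup>+x. indicator ?T x \<partial>distr uniform borel (laplace_quantile ?b))"
    using T by simp
  also have "\<dots> = (\<integral>\<^sup>+v. indicator ?T (laplace_quantile ?b v) \<partial>uniform)"
    by (rule nn_integral_distr[OF meas]) (use T in simp)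
  also have "\<dots> = (\<integral>\<^sup>+v. indicator S (sampler m \<epsilon> \<beta> D u v) \<partial>uniform)"
    by (intro nn_integral_cong) (simp add: sampler_def Let_def indicator_def)
  finally show ?thesis ..
qed

lemma measurable_random_tape [measurable]: "(\<lambda>\<omega>. \<omega> !! n) \<in> borel_measurable random_tape"
proof -
  have "(\<lambda>\<omega>. \<omega> !! n) \<in> random_tape \<rightarrow>\<^sub>M uniform"
    unfolding random_tape_def by measurable
  then show ?thesis by (simp cong: measurable_cong_sets)
qed

text \<open>Two samples are peeled off the tape. Integrating over the second yields
  \<open>noisy_count\<close> at the picked level, and the first distributes that level as GEM
  does.\<close>

lemma distr_sampler:
  assumes "\<epsilon> > 0" "1 \<le> m"
  shows "distr random_tape output_space (\<lambda>\<omega>. sampler m \<epsilon> \<beta> D (\<omega> !! 0) (\<omega> !! 1)) =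
    dp_approx_distinct_count m \<epsilon> \<beta> D"
proof (rule measure_eqI)
  interpret U: prob_space uniform by (rule prob_space_uniform)
  interpret R: prob_space random_tape unfolding random_tape_def by (rule U.prob_space_stream_space)
  let ?f = "\<lambda>\<omega>. sampler m \<epsilon> \<beta> D (\<omega> !! 0) (\<omega> !! 1)" and ?w = "gem_weight D m \<epsilon> \<beta>"
  have f: "?f \<in> random_tape \<rightarrow>\<^sub>M output_space" by measurable
  fix S assume "S \<in> sets (distr random_tape output_space ?f)"
  then have S [measurable]: "S \<in> sets output_space" by simp
  have meas: "pick m ?w \<in> uniform \<rightarrow>\<^sub>M count_space UNIV"
    using measurable_pick[of m ?w] by (simp cong: measurable_cong_sets)
  have "emeasure (distr random_tape output_space ?f) S =
      (\<integral>\<^sup>+x. indicator S x \<partial>distr random_tape output_space ?f)" by simp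
  also have "\<dots> = (\<integral>\<^sup>+\<omega>. indicator S (?f \<omega>) \<partial>random_tape)"
    by (rule nn_integral_distr[OF f]) simp
  also have "\<dots> = (\<integral>\<^sup>+u. \<integral>\<^sup>+\<omega>. indicator S (?f (u ## \<omega>)) \<partial>random_tape \<partial>uniform)"
    unfolding random_tape_def
    by (rule U.nn_integral_stream_space, fold random_tape_def) measurable
  also have "\<dots> = (\<integral>\<^sup>+u. \<integral>\<^sup>+\<omega>. indicator S (sampler m \<epsilon> \<beta> D u (\<omega> !! 0)) \<partial>random_tape \<partial>uniform)"
    by simp
  also have "\<dots> = (\<integral>\<^sup>+u. \<integral>\<^sup>+v. indicator S (sampler m \<epsilon> \<beta> D u v) \<partial>uniform \<partial>uniform)"
  proof (intro nn_integral_cong)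
    fix u
    have "(\<integral>\<^sup>+\<omega>. indicator S (sampler m \<epsilon> \<beta> D u (\<omega> !! 0)) \<partial>random_tape) =
        (\<integral>\<^sup>+v. \<integral>\<^sup>+\<omega>. indicator S (sampler m \<epsilon> \<beta> D u ((v ## \<omega>) !! 0)) \<partial>random_tape \<partial>uniform)"
      unfolding random_tape_def
      by (rule U.nn_integral_stream_space, fold random_tape_def) measurable
    then show "(\<integral>\<^sup>+\<omega>. indicator S (sampler m \<epsilon> \<beta> D u (\<omega> !! 0)) \<partial>random_tape) =
        (\<integral>\<^sup>+v. indicator S (sampler m \<epsilon> \<beta> D u v) \<partial>uniform)"
      by (simp add: R.emeasure_space_1)
  qed
  also have "\<dots> = (\<integral>\<^sup>+u. emeasure (noisy_count \<epsilon> \<beta> D (pick m ?w u)) S \<partial>uniform)"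
    by (simp only: nn_integral_sampler[OF assms S])
  also have "\<dots> = (\<integral>\<^sup>+l. emeasure (noisy_count \<epsilon> \<beta> D l) S \<partial>distr uniform (count_space UNIV) (pick m ?w))"
    by (rule nn_integral_distr[OF meas, symmetric]) simp
  also have "\<dots> = emeasure (dp_approx_distinct_count m \<epsilon> \<beta> D) S"
    by (simp only: distr_uniform_pick[OF assms(2)] emeasure_dp[OF assms(1) S])
  finally show "emeasure (distr random_tape output_space ?f) S =
      emeasure (dp_approx_distinct_count m \<epsilon> \<beta> D) S" .
qed (use assms in simp)

section \<open>The step count in terms of the natural logarithm\<close>

lemma floor_log_le_ln:
  assumes "n > 0"
  shows "real (floor_log n) \<le> 2 * ln (real n)"
proof -
  have "2 ^ floor_log n \<le> n" using assms by (rule floor_log_exp2_le)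
  then have "(2::real) ^ floor_log n \<le> real n" by (metis of_nat_le_iff of_nat_numeral of_nat_power)
  then have "ln ((2::real) ^ floor_log n) \<le> ln (real n)" using assms by (subst ln_le_cancel_iff) auto
  then have "real (floor_log n) * ln 2 \<le> ln (real n)" by (simp add: ln_realpow)
  moreover have "real (floor_log n) * (1 / 2) \<le> real (floor_log n) * ln 2"
    using ln2_ge_two_thirds by (intro mult_left_mono) linarith+
  ultimately show ?thesis by linarith
qed

text \<open>The maximum with 1 absorbs the constant cost when \<open>d = 0\<close> and
  \<open>m = 1\<close>, where the other term vanishes. It also bounds \<open>m\<close> for
  \<open>m = 1\<close>; for larger \<open>m\<close> the factor \<open>ln m\<close> is at least
  1/2.\<close>

lemma running_time_bound:
  assumes "1 \<le> m"
  shows "real (15 + 20 * d + m * (22 + 4 * floor_log (2 * m))) \<le>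
    95 * max 1 (real d + real m * ln (real m))"
proof -
  define X where "X = real m * ln (real m)"
  define Z where "Z = max 1 (real d + X)"
  have X0: "0 \<le> X" using assms by (simp add: X_def)
  have Z: "1 \<le> Z" "X \<le> Z" "real d \<le> Z" using X0 by (auto simp: Z_def)
  have mZ: "real m \<le> 2 * Z"
  proof (cases "m = 1")
    case False
    then have "ln 2 \<le> ln (real m)" using assms by simp
    then have "1 / 2 \<le> ln (real m)" using ln2_ge_two_thirds by linarith
    then have "real m * (1 / 2) \<le> X" unfolding X_def by (intro mult_left_mono) auto
    with Z show ?thesis by linarith
  qed (use Z in simp)
  have "real m * real (floor_log m) \<le> real m * (2 * ln (real m))"
    using floor_log_le_ln[of m] assms by (intro mult_left_mono) auto
  then have mf: "real m * real (floor_log m) \<le> 2 * Z" using Z by (simp add: X_def)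
  have "floor_log (2 * m) = Suc (floor_log m)" using assms by (intro floor_log_twice) auto
  then have "real (15 + 20 * d + m * (22 + 4 * floor_log (2 * m))) =
      15 + 20 * real d + 26 * real m + 4 * (real m * real (floor_log m))"
    by (simp add: algebra_simps)
  \<comment> \<open>The constant is \<open>15 + 20 + 26 * 2 + 4 * 2\<close>.\<close>
  also have "\<dots> \<le> 95 * Z" using Z mZ mf by linarith
  finally show ?thesis unfolding Z_def X_def .
qed

lemma program_implements:
  assumes "\<epsilon> > 0" "1 \<le> m" "D \<in> datasets"
  shows "implements_in_time program (init_state m \<epsilon> \<beta> D) (dp_approx_distinct_count m \<epsilon> \<beta> D)
    (95 * max 1 (real (dataset_size D) + real m * ln (real m)))"
  unfolding implements_in_time_def
proof (intro bexI conjI allI)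
  show "distr random_tape output_space (\<lambda>\<omega>. sampler m \<epsilon> \<beta> D (\<omega> !! 0) (\<omega> !! 1)) =
      dp_approx_distinct_count m \<epsilon> \<beta> D"
    using assms by (intro distr_sampler)
  fix \<omega>
  obtain k s where "exec program (init_state m \<epsilon> \<beta> D \<omega>) k s"
      "result s = sampler m \<epsilon> \<beta> D (\<omega> !! 0) (\<omega> !! 1)"
      "k \<le> 15 + 20 * dataset_size D + m * (22 + 4 * floor_log (2 * m))"
    using program_correct[OF assms(3,2)] unfolding wp_def sampler_def by blast
  moreover from this(3) have "real k \<le> 95 * max 1 (real (dataset_size D) + real m * ln (real m))"
    using running_time_bound[OF assms(2), of "dataset_size D"] by linarith
  ultimately show "\<exists>k s. exec program (init_state m \<epsilon> \<beta> D \<omega>) k s \<and>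
      result s = sampler m \<epsilon> \<beta> D (\<omega> !! 0) (\<omega> !! 1) \<and>
      real k \<le> 95 * max 1 (real (dataset_size D) + real m * ln (real m))" by blast
qed measurable

theorem theorem1p2:
  shows "(\<forall>(\<epsilon>::real) (\<beta>::real) (lmax::nat). 0 < \<epsilon> \<and> 0 < \<beta> \<and> \<beta> < 1 / 2 \<and> 1 \<le> lmax \<longrightarrow>
      differentially_private \<epsilon> output_space
        (dp_approx_distinct_count lmax \<epsilon> \<beta> :: 'a::linorder set list \<Rightarrow> (nat \<times> real) measure) \<and>
      (\<forall>D::'a set list. D \<in> datasets \<longrightarrow>
        \<P>(p in dp_approx_distinct_count lmax \<epsilon> \<beta> D. snd p \<le> real (distinct_count D)) \<ge> 1 - \<beta>) \<and>
      (\<forall>(D::'a set list) (lstar::nat).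
        D \<in> datasets \<and> (\<forall>u\<in>set D. card u \<le> lstar) \<and> 1 \<le> lstar \<and> lstar \<le> lmax \<longrightarrow>
        \<P>(p in dp_approx_distinct_count lmax \<epsilon> \<beta> D.
          snd p \<ge> 1 / 2 * real (distinct_count D)
                    - 28 * real lstar / \<epsilon> * ln (real lmax / \<beta>)) \<ge> 1 - 2 * \<beta>)) \<and>
    (\<exists>(c::com) (C::real).
      \<forall>(\<epsilon>::real) (\<beta>::real) (lmax::nat) (D::'a set list).
        0 < \<epsilon> \<and> 0 < \<beta> \<and> \<beta> < 1 / 2 \<and> 1 \<le> lmax \<and> D \<in> datasets \<longrightarrow>
        implements_in_time c (init_state lmax \<epsilon> \<beta> D) (dp_approx_distinct_count lmax \<epsilon> \<beta> D)
          (C * max 1 (real (dataset_size D) + real lmax * ln (real lmax))))"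
proof (intro conjI allI impI, goal_cases)
  case (1 \<epsilon> \<beta> lmax)
  then show ?case by (intro dp_approx_distinct_count_private) auto
next
  case (2 \<epsilon> \<beta> lmax D)
  then show ?case using dp_approx_distinct_count_lower[of \<epsilon> \<beta> lmax D] by simp
next
  case (3 \<epsilon> \<beta> lmax D lstar)
  then show ?case using dp_approx_distinct_count_upper[of \<epsilon> \<beta> D lstar lmax] by simp
next
  case 4
  \<comment> \<open>Program and constant are fixed before the parameters and the dataset.\<close>
  show ?case by (intro exI[of _ program] exI[of _ 95] allI impI program_implements) auto
qed

end
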